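(* The strict competitive ratio of Reopt satisfies the following upper bounds: in the picking system Pcart-N, $$\sigma(Reopt)\le 2.5;$$ in each of the picking systems Pcart and Robot, $$\sigma(Reopt)\le 4.$$
   Context: Warehouse. A warehouse is a rectilinear grid of length $L$ and width $W$ consisting of $a\ge 1$ equidistant parallel (vertical) aisles, each a segment of length $W$, and $b\ge 2$ equidistant (horizontal) cross-aisles, each a segment of length $L$; the outermost aisles and cross-aisles form the border of the grid (for $a=1$, $L=0$). The picker moves along aisles and cross-aisles at unit speed (and may wait); $d$ is the resulting shortest-path metric. The depot $l_d$ is a fixed point of the grid. Picking locations are points in aisles. Instance. An instance $I$ consists of the infrastructure ($W,L,a,b,l_d$ and the batching capacity $c\in\mathbb{N}$), a sequence of orders $o_1,\ldots,o_n$, where $o_j=\{s_j^1,\ldots,s_j^{k(j)}\}$ is a set of $k(j)\ge1$ picking locations (items), and arrival times $0\le r_1\le\ldots\le r_n$. The picker starts at $l_d$ at time 0. A solution partitions the orders into batches of at most $c$ orders, sequences the batches, and fixes for each batch a visiting sequence of all picking locations of its orders. Batches are processed one after another; an item of $o_j$ cannot be picked before $r_j$; picking itself takes zero time; an order cannot be split between batches. With a pushcart, every batch starts at the depot and ends with the picker's return to the depot, and the objective (total completion time) is the time of the final return to the depot. With a robot, the picker starts the next batch from the location where she picked the last item of the previous batch (a new empty robot is immediately available there), and the objective is the time at which the last item is picked. $CIOPT(I)$ is the minimum objective value when the whole instance is known in advance (the picker may then move towards locations of orders that have not arrived yet). Online policy Reopt and the three systems. Online, the number of orders is unknown and each order (with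 its picking locations) becomes known only at its arrival time. Reopt never anticipates future orders; when it reoptimizes at time $t$, it computes a plan with minimal total completion time for the orders that have arrived by $t$ and have not been completely picked, treating them as immediately available, and follows this plan until the next reoptimization; if there is nothing left to do, the picker stays where she is (at the depot initially and in the pushcart systems). - Pcart-N (pushcart, non-interventionist Reopt): reoptimization takes place only when the picker is at the depot (on each return to the depot if new orders have arrived, or on arrival of an order while she is idle at the depot); started batches cannot be modified. - Pcart (pushcart, interventionist Reopt) and Robot (robot, interventionist Reopt): reoptimization takes place at every order arrival; the plan starts from the picker's current position, orders having at least one item already in the current cart must be completed as part of the current batch, and all other bins of the current cart (of $c$ bins, one order per bin) can be freely (re)assigned to not yet commenced orders. Ties between optimal plans are broken by an arbitrary fixed deterministic rule. $Reopt(I)$ is the resulting total completion time (pushcart or robot objective according to the system), and $CIOPT(I)$ is taken for the same cart type. Strict competitive ratio. $\sigma(ALG)=\sup_I \frac{ALG(I)}{CIOPT(I)}$, the supremum over all instances $I$ of the problem (with the convention $0/0=1$). *)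

theory Defs
  imports "HOL-Analysis.Analysis" "HOL-Library.While_Combinator"
begin

type_synonym point = "real \<times> real"

text \<open>An order is its arrival time together with its set of picking locations. Orders are
  referred to by their (0-based) position in the list of orders, and an item by the pair of its
  order and its location, so that distinct orders may share a location.\<close>

type_synonym item = "nat \<times> point"

record inst =
  wh_length :: real
  wh_width :: real
  n_aisles :: nat
  n_cross :: nat
  depot :: point
  capacity :: nat
  orders :: "(real \<times> point set) list"

subsection \<open>Warehouse\<close>

text \<open>For one aisle the quotient is \<open>0 / 0 = 0\<close>, i.e. the aisle is at abscissa 0.\<close>

definition aisles :: "inst \<Rightarrow> point set" where
  "aisles I = {(x, y). (\<exists>i < n_aisles I. x = real i * wh_length I / (real (n_aisles I) - 1)) \<and>
     0 \<le> y \<and> y \<le> wh_width I}"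

definition cross_aisles :: "inst \<Rightarrow> point set" where
  "cross_aisles I = {(x, y). (\<exists>i < n_cross I. y = real i * wh_width I / (real (n_cross I) - 1)) \<and>
     0 \<le> x \<and> x \<le> wh_length I}"

definition grid :: "inst \<Rightarrow> point set" where
  "grid I = aisles I \<union> cross_aisles I"

text \<open>Movements of the picker during a time interval: she stays in the grid and never exceeds
  unit speed (slower movement amounts to waiting).\<close>

definition movement :: "inst \<Rightarrow> real \<Rightarrow> real \<Rightarrow> (real \<Rightarrow> point) \<Rightarrow> bool" where
  "movement I s t \<gamma> \<longleftrightarrow> s \<le> t \<and> 1-lipschitz_on {s..t} \<gamma> \<and> \<gamma> ` {s..t} \<subseteq> grid I"

definition gdist :: "inst \<Rightarrow> point \<Rightarrow> point \<Rightarrow> real" where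
  "gdist I p q = Inf {T. \<exists>\<gamma>. movement I 0 T \<gamma> \<and> \<gamma> 0 = p \<and> \<gamma> T = q}"

subsection \<open>Instances\<close>

definition arrival :: "inst \<Rightarrow> nat \<Rightarrow> real" where
  "arrival I j = fst (orders I ! j)"

definition items :: "inst \<Rightarrow> item set" where
  "items I = {(j, s). j < length (orders I) \<and> s \<in> snd (orders I ! j)}"

definition valid_inst :: "inst \<Rightarrow> bool" where
  "valid_inst I \<longleftrightarrow>
     0 < wh_width I \<and> 1 \<le> n_aisles I \<and> 2 \<le> n_cross I \<and>
     (if n_aisles I = 1 then wh_length I = 0 else 0 < wh_length I) \<and>
     depot I \<in> grid I \<and> 1 \<le> capacity I \<and>
     orders I \<noteq> [] \<and> sorted (map fst (orders I)) \<and>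
     (\<forall>(r, S) \<in> set (orders I). 0 \<le> r \<and> finite S \<and> S \<noteq> {} \<and> S \<subseteq> aisles I)"

subsection \<open>Plans\<close>

datatype cart_type = Pushcart | RobotCart

text \<open>The picker's position, the items picked so far, and the orders with at least one item in
  the current cart (including orders in it that are already complete).\<close>

record state =
  pos :: point
  picked :: "item set"
  cart :: "nat set"

definition init_state :: "inst \<Rightarrow> state" where
  "init_state I = \<lparr>pos = depot I, picked = {}, cart = {}\<rparr>"

text \<open>A plan is a sequence of batches, each given by its visiting sequence of items. If the
  current cart holds items, the first batch is the continuation of the current one: it
  also contains the orders in the cart, which use up bins and must not be split, and may have
  no further items.\<close>

definition batch_orders :: "state \<Rightarrow> item list list \<Rightarrow> nat \<Rightarrow> nat set" where
  "batch_orders st Bs i = fst ` set (Bs ! i) \<union> (if i = 0 then cart st else {})"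

definition feasible :: "inst \<Rightarrow> state \<Rightarrow> item list list \<Rightarrow> bool" where
  "feasible I st Bs \<longleftrightarrow>
     distinct (concat Bs) \<and> set (concat Bs) = items I - picked st \<and>
     (\<forall>i < length Bs. batch_orders st Bs i \<noteq> {} \<and> card (batch_orders st Bs i) \<le> capacity I) \<and>
     (\<forall>i < length Bs. \<forall>j < length Bs. i \<noteq> j \<longrightarrow> batch_orders st Bs i \<inter> batch_orders st Bs j = {}) \<and>
     (cart st \<noteq> {} \<longrightarrow> Bs \<noteq> [])"

text \<open>\<open>Close\<close> ends a batch: a pushcart is brought back to the depot, a robot is released at the
  picker's current position.\<close>

datatype event = Pick item | Close

definition events :: "item list list \<Rightarrow> event list" where
  "events Bs = concat (map (\<lambda>B. map Pick B @ [Close]) Bs)"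

definition close_pos :: "cart_type \<Rightarrow> inst \<Rightarrow> point \<Rightarrow> point" where
  "close_pos ct I p = (case ct of Pushcart \<Rightarrow> depot I | RobotCart \<Rightarrow> p)"

text \<open>Times and places of the events for a picker who is at \<open>p\<close> at time \<open>t\<close>,
  where no item of order \<open>j\<close> can be picked before \<open>\<rho> j\<close>.\<close>

fun timeline :: "cart_type \<Rightarrow> inst \<Rightarrow> (nat \<Rightarrow> real) \<Rightarrow> real \<Rightarrow> point \<Rightarrow> event list \<Rightarrow> (real \<times> point) list"
where
  "timeline ct I \<rho> t p [] = []"
| "timeline ct I \<rho> t p (Pick (j, s) # es) =
     (let t' = max (t + gdist I p s) (\<rho> j) in (t', s) # timeline ct I \<rho> t' s es)"
| "timeline ct I \<rho> t p (Close # es) =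
     (let q = close_pos ct I p; t' = t + gdist I p q in (t', q) # timeline ct I \<rho> t' q es)"

text \<open>For robots, the last \<open>Close\<close> takes place at the time of the last pick.\<close>

definition completion :: "cart_type \<Rightarrow> inst \<Rightarrow> (nat \<Rightarrow> real) \<Rightarrow> real \<Rightarrow> point \<Rightarrow> item list list \<Rightarrow> real" where
  "completion ct I \<rho> t p Bs = last (t # map fst (timeline ct I \<rho> t p (events Bs)))"

definition CIOPT :: "cart_type \<Rightarrow> inst \<Rightarrow> real" where
  "CIOPT ct I = Inf {completion ct I (arrival I) 0 (depot I) Bs | Bs. feasible I (init_state I) Bs}"

subsection \<open>Reoptimization\<close>

definition known :: "inst \<Rightarrow> real \<Rightarrow> inst" where
  "known I t = I\<lparr>orders := filter (\<lambda>(r, S). r \<le> t) (orders I)\<rparr>"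

text \<open>\<open>\<gamma>\<close> is a movement that carries out the batches \<open>Bs\<close>, started at time \<open>t\<close> from \<open>pos st\<close>, at
  the times given by the timeline; every leg is then a shortest path. There may be several.\<close>

definition route :: "cart_type \<Rightarrow> inst \<Rightarrow> real \<Rightarrow> state \<Rightarrow> item list list \<Rightarrow> (real \<Rightarrow> point) \<Rightarrow> bool" where
  "route ct I t st Bs \<gamma> \<longleftrightarrow>
     movement I t (completion ct I (\<lambda>_. t) t (pos st) Bs) \<gamma> \<and> \<gamma> t = pos st \<and>
     (\<forall>(t', q) \<in> set (timeline ct I (\<lambda>_. t) t (pos st) (events Bs)). \<gamma> t' = q)"

text \<open>In the following, \<open>I\<close> consists of the orders known at the time \<open>t\<close> of
  reoptimization, all of which are treated as immediately available.\<close>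

definition optimal_plan ::
  "cart_type \<Rightarrow> inst \<Rightarrow> real \<Rightarrow> state \<Rightarrow> item list list \<times> (real \<Rightarrow> point) \<Rightarrow> bool" where
  "optimal_plan ct I t st = (\<lambda>(Bs, \<gamma>).
     feasible I st Bs \<and>
     (\<forall>Bs'. feasible I st Bs' \<longrightarrow>
        completion ct I (\<lambda>_. t) t (pos st) Bs \<le> completion ct I (\<lambda>_. t) t (pos st) Bs') \<and>
     route ct I t st Bs \<gamma>)"

type_synonym rule = "inst \<Rightarrow> real \<Rightarrow> state \<Rightarrow> item list list \<times> (real \<Rightarrow> point)"

text \<open>A deterministic way of selecting one of the optimal plans in every situation. The rule is
  only ever applied to \<open>known I t\<close>.\<close>

definition tie_breaking_rule :: "cart_type \<Rightarrow> rule \<Rightarrow> bool" where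
  "tie_breaking_rule ct \<tau> \<longleftrightarrow>
     (\<forall>I t st. (\<exists>P. optimal_plan ct I t st P) \<longrightarrow> optimal_plan ct I t st (\<tau> I t st))"

subsubsection \<open>Interventionist systems\<close>

fun load :: "event \<Rightarrow> nat set \<Rightarrow> nat set" where
  "load (Pick (j, s)) K = insert j K"
| "load Close K = {}"

text \<open>The state at time \<open>t'\<close> if a plan computed in state \<open>st\<close> at time \<open>t\<close> is followed in the
  meantime. Events due exactly at \<open>t'\<close> have taken place.\<close>

definition follow ::
  "cart_type \<Rightarrow> inst \<Rightarrow> real \<Rightarrow> state \<Rightarrow> item list list \<times> (real \<Rightarrow> point) \<Rightarrow> real \<Rightarrow> state" where
  "follow ct I t st = (\<lambda>(Bs, \<gamma>) t'.
     let tl = timeline ct I (\<lambda>_. t) t (pos st) (events Bs);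
         es = take (length (takeWhile (\<lambda>(u, q). u \<le> t') tl)) (events Bs)
     in \<lparr>pos = \<gamma> (min t' (completion ct I (\<lambda>_. t) t (pos st) Bs)),
         picked = picked st \<union> {x. Pick x \<in> set es},
         cart = fold load es (cart st)\<rparr>)"

text \<open>The list argument contains the remaining times of reoptimization.\<close>

fun reopt_from :: "cart_type \<Rightarrow> rule \<Rightarrow> inst \<Rightarrow> state \<Rightarrow> real list \<Rightarrow> real" where
  "reopt_from ct \<tau> I st [] = 0"
| "reopt_from ct \<tau> I st [t] = completion ct I (\<lambda>_. t) t (pos st) (fst (\<tau> (known I t) t st))"
| "reopt_from ct \<tau> I st (t # t' # ts) =
     reopt_from ct \<tau> I (follow ct I t st (\<tau> (known I t) t st) t') (t' # ts)"

definition reopt_interventionist :: "cart_type \<Rightarrow> rule \<Rightarrow> inst \<Rightarrow> real" where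
  "reopt_interventionist ct \<tau> I =
     reopt_from ct \<tau> I (init_state I) (remdups (map fst (orders I)))"

subsubsection \<open>Non-interventionist pushcart system\<close>

text \<open>The picker is at the depot at time \<open>now\<close>; \<open>seen\<close> is the number of orders
  that were known at the last reoptimization, and \<open>todo\<close> is the part of the plan computed
  there that has not been started.\<close>

record depot_state =
  now :: real
  seen :: nat
  collected :: "item set"
  todo :: "item list list"

definition depot_step :: "rule \<Rightarrow> inst \<Rightarrow> depot_state \<Rightarrow> depot_state" where
  "depot_step \<tau> I s =
     (let I' = known I (now s) in
      if seen s < length (orders I') then
        s\<lparr>seen := length (orders I'),
          todo := fst (\<tau> I' (now s) \<lparr>pos = depot I, picked = collected s, cart = {}\<rparr>)\<rparr>
      else if todo s \<noteq> [] then
        s\<lparr>now := completion Pushcart I (\<lambda>_. now s) (now s) (depot I) [hd (todo s)],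
          collected := collected s \<union> set (hd (todo s)),
          todo := tl (todo s)\<rparr>
      else s\<lparr>now := arrival I (seen s)\<rparr>)"

definition reopt_noninterventionist :: "rule \<Rightarrow> inst \<Rightarrow> real" where
  "reopt_noninterventionist \<tau> I =
     now (while (\<lambda>s. seen s < length (orders I) \<or> todo s \<noteq> []) (depot_step \<tau> I)
            \<lparr>now = 0, seen = 0, collected = {}, todo = []\<rparr>)"

subsubsection \<open>Systems and strict competitive ratio\<close>

datatype system = PcartN | Pcart | Robot

fun cart_of :: "system \<Rightarrow> cart_type" where
  "cart_of PcartN = Pushcart"
| "cart_of Pcart = Pushcart"
| "cart_of Robot = RobotCart"

fun Reopt :: "system \<Rightarrow> rule \<Rightarrow> inst \<Rightarrow> real" where
  "Reopt PcartN \<tau> I = reopt_noninterventionist \<tau> I"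
| "Reopt Pcart \<tau> I = reopt_interventionist Pushcart \<tau> I"
| "Reopt Robot \<tau> I = reopt_interventionist RobotCart \<tau> I"

text \<open>For \<open>x > 0\<close> the extended real quotient \<open>x / 0\<close> is \<open>\<infinity>\<close>.\<close>

definition ratio :: "real \<Rightarrow> real \<Rightarrow> ereal" where
  "ratio x y = (if x = 0 \<and> y = 0 then 1 else ereal x / ereal y)"

definition strict_competitive_ratio :: "cart_type \<Rightarrow> (inst \<Rightarrow> real) \<Rightarrow> ereal" where
  "strict_competitive_ratio ct alg = (SUP I \<in> {I. valid_inst I}. ratio (alg I) (CIOPT ct I))"

end

theory Submission
  imports Defs "HOL-Complex_Analysis.Great_Picard" "HOL-Library.Sublist"
begin

text \<open>Fix any solution, given by its batches \<open>Bs\<close>, let \<open>C\<close> be its value and \<open>S\<close> the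
  length of its tour. Then \<open>S \<le> C\<close>, and every arrival time is at most \<open>C\<close>
  (\<open>completion_bounds\<close>). It is enough to bound Reopt by the respective multiple of \<open>C\<close>
  (\<open>ratio_CIOPT_le\<close>).

  In the interventionist systems, what counts is the plan made at the last arrival, at time \<open>t\<close>.
  The picker is then within distance \<open>t\<close> of the depot, and one way to finish is to walk back to
  the depot and go along the tour of \<open>Bs\<close> twice, picking the remaining items of the orders in
  the cart in the first pass and everything else in the second. A pushcart is back at the depot
  between the passes; a robot picker makes the second pass backwards, which is possible because the
  batches of a robot solution can be carried out in reverse. Reopt is optimal for the known orders,
  so it needs at most \<open>t + (t + 2 * S) \<le> 4 * C\<close> in total (\<open>path_length_resume\<close>,
  \<open>reopt_interventionist_le\<close>).

  In the non-interventionist system, consider the last reoptimization, at which the late orders, those not seen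
  before, become part of the plan. Let \<open>t\<close> be the time of the reoptimization before, or the end of an
  idle period since, or 0 in the absence of both. The plan in force has been at most as long as \<open>S\<close>,
  hence can be completed by time \<open>t + S\<close>, and appending the late orders to it is one option. The late
  orders arrive at \<open>t\<close> or later. Therefore the solution still has to run through its tour from the first
  late item \<open>x\<close> on after time \<open>t\<close>, and this together with the way from the depot to
  \<open>x\<close>, which is at most \<open>S / 2\<close>, serves all late orders (\<open>late_items\<close>). This
  gives \<open>(t + S) + (C - t + S / 2) \<le> 5 / 2 * C\<close>.

  Both arguments compare Reopt with competing plans and so require that optimal plans exist at all,
  including a movement along shortest paths. The distance is an infimum over movements; that it is
  attained (\<open>gdist_attained\<close>) follows by compactness.\<close>

section \<open>Shortest paths in the warehouse\<close>

text \<open>Distances and movements depend on the grid alone. Keeping orders out of this locale makes its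
  results available for \<open>known I t\<close> at every time \<open>t\<close>, even when no order is known.\<close>

locale warehouse =
  fixes I :: inst
  assumes wh: "0 \<le> wh_length I" "0 \<le> wh_width I" "1 \<le> n_aisles I" "2 \<le> n_cross I"
    and depot_grid: "depot I \<in> grid I"
begin

lemma movement_const: "p \<in> grid I \<Longrightarrow> s \<le> t \<Longrightarrow> movement I s t (\<lambda>_. p)"
  by (auto simp: movement_def lipschitz_on_def)

lemma movement_shift:
  assumes "movement I s t \<gamma>"
  shows "movement I (s + c) (t + c) (\<lambda>u. \<gamma> (u - c))"
proof -
  have "dist (\<gamma> (x - c)) (\<gamma> (y - c)) \<le> dist x y" if "x \<in> {s + c..t + c}" "y \<in> {s + c..t + c}" for x y
    using assms that lipschitz_onD[of 1 "{s..t}" \<gamma> "x - c" "y - c"]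
    by (auto simp: movement_def dist_real_def)
  then have "1-lipschitz_on {s + c..t + c} (\<lambda>u. \<gamma> (u - c))"
    by (auto simp: lipschitz_on_def)
  moreover have "\<gamma> (u - c) \<in> grid I" if "u \<in> {s + c..t + c}" for u
  proof -
    have "u - c \<in> {s..t}" using that by auto
    then show ?thesis using assms by (auto simp: movement_def)
  qed
  ultimately show ?thesis
    using assms by (auto simp: movement_def)
qed

lemma movement_reverse:
  assumes "movement I 0 T \<gamma>"
  shows "movement I 0 T (\<lambda>u. \<gamma> (T - u))"
proof -
  have "dist (\<gamma> (T - x)) (\<gamma> (T - y)) \<le> dist x y" if "x \<in> {0..T}" "y \<in> {0..T}" for x y
    using assms that lipschitz_onD[of 1 "{0..T}" \<gamma> "T - x" "T - y"]
    by (auto simp: movement_def dist_real_def)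
  then have "1-lipschitz_on {0..T} (\<lambda>u. \<gamma> (T - u))"
    by (auto simp: lipschitz_on_def)
  moreover have "\<gamma> (T - u) \<in> grid I" if "u \<in> {0..T}" for u
  proof -
    have "T - u \<in> {0..T}" using that by auto
    then show ?thesis using assms by (auto simp: movement_def)
  qed
  ultimately show ?thesis
    using assms by (auto simp: movement_def)
qed

lemma movement_join:
  assumes "movement I r s \<gamma>" "movement I s t \<delta>" "\<gamma> s = \<delta> s"
  shows "movement I r t (\<lambda>u. if u \<le> s then \<gamma> u else \<delta> u)"
  using assms lipschitz_on_concat[of 1 r s \<gamma> t \<delta>]
  by (auto simp: movement_def image_subset_iff)

lemma movement_subinterval:
  assumes "movement I s t \<gamma>" "s \<le> s'" "s' \<le> t'" "t' \<le> t"
  shows "movement I s' t' \<gamma>"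
  using assms lipschitz_on_subset[of 1 "{s..t}" \<gamma> "{s'..t'}"]
  by (auto simp: movement_def image_subset_iff)

text \<open>The set whose infimum is the distance: \<open>T\<close> is a possible duration of a movement from \<open>p\<close>
  to \<open>q\<close>.\<close>

definition joined :: "point \<Rightarrow> point \<Rightarrow> real \<Rightarrow> bool" where
  "joined p q T \<longleftrightarrow> (\<exists>\<gamma>. movement I 0 T \<gamma> \<and> \<gamma> 0 = p \<and> \<gamma> T = q)"

lemma gdist_joined: "gdist I p q = Inf {T. joined p q T}"
  by (simp add: gdist_def joined_def)

lemma joined_nonneg: "joined p q T \<Longrightarrow> 0 \<le> T"
  by (auto simp: joined_def movement_def)

lemma joined_movement:
  assumes "movement I s t \<gamma>"
  shows "joined (\<gamma> s) (\<gamma> t) (t - s)"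
  unfolding joined_def using movement_shift[OF assms, of "- s"]
  by (intro exI[of _ "\<lambda>u. \<gamma> (u + s)"]) auto

lemma joined_refl: "p \<in> grid I \<Longrightarrow> joined p p 0"
  using movement_const joined_def by blast

lemma joined_sym: "joined p q T \<Longrightarrow> joined q p T"
  unfolding joined_def using movement_reverse by fastforce

lemma joined_trans:
  assumes "joined p q T" "joined q r U"
  shows "joined p r (T + U)"
proof -
  obtain \<gamma> where \<gamma>: "movement I 0 T \<gamma>" "\<gamma> 0 = p" "\<gamma> T = q"
    using assms(1) by (auto simp: joined_def)
  obtain \<delta> where \<delta>: "movement I 0 U \<delta>" "\<delta> 0 = q" "\<delta> U = r"
    using assms(2) by (auto simp: joined_def)
  have \<delta>': "movement I T (U + T) (\<lambda>u. \<delta> (u - T))"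
    using movement_shift[OF \<delta>(1), of T] by simp
  have "movement I 0 (T + U) (\<lambda>u. if u \<le> T then \<gamma> u else \<delta> (u - T))"
    using movement_join[OF \<gamma>(1) \<delta>'] \<gamma> \<delta> by (simp add: add.commute)
  moreover have "0 \<le> T" "0 \<le> U" using \<gamma> \<delta> by (auto simp: movement_def)
  ultimately show ?thesis
    unfolding joined_def using \<gamma> \<delta>
    by (intro exI[of _ "\<lambda>u. if u \<le> T then \<gamma> u else \<delta> (u - T)"]) auto
qed

text \<open>The picker can run along a segment at constant speed. Granting her one unit of time more than
  necessary avoids a division by zero when the end points coincide.\<close>

lemma joined_segment:
  assumes "closed_segment p q \<subseteq> grid I"
  shows "\<exists>T. joined p q T"
proof -
  define T where "T = dist p q + 1"
  have T: "T > 0" "dist p q \<le> T" by (auto simp: T_def add_nonneg_pos)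
  define \<gamma> where "\<gamma> u = linepath p q (u / T)" for u
  have "dist (\<gamma> x) (\<gamma> y) \<le> dist x y" for x y
  proof -
    have "\<gamma> x - \<gamma> y = ((x - y) / T) *\<^sub>R (q - p)"
      by (simp add: \<gamma>_def linepath_def algebra_simps diff_divide_distrib)
    then have "dist (\<gamma> x) (\<gamma> y) = \<bar>x - y\<bar> * (dist p q / T)"
      using T by (simp add: dist_norm norm_minus_commute)
    also have "\<dots> \<le> \<bar>x - y\<bar> * 1"
      using T by (intro mult_left_mono) auto
    finally show ?thesis by (simp add: dist_real_def)
  qed
  then have "1-lipschitz_on {0..T} \<gamma>" by (auto simp: lipschitz_on_def)
  moreover have "\<gamma> u \<in> closed_segment p q" if "u \<in> {0..T}" for u
    unfolding \<gamma>_def using T that by (intro linepath_in_path) auto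
  ultimately have "movement I 0 T \<gamma>"
    using T assms by (auto simp: movement_def)
  moreover have "\<gamma> 0 = p" "\<gamma> T = q" using T by (auto simp: \<gamma>_def linepath_def)
  ultimately show ?thesis unfolding joined_def by blast
qed

lemma joined_convex:
  assumes "convex A" "A \<subseteq> grid I" "p \<in> A" "q \<in> A"
  shows "\<exists>T. joined p q T"
  using joined_segment closed_segment_subset[OF assms(3,4,1)] assms(2) by auto

lemma aisle_subset:
  "i < n_aisles I \<Longrightarrow> {real i * wh_length I / (real (n_aisles I) - 1)} \<times> {0..wh_width I} \<subseteq> grid I"
  by (auto simp: grid_def aisles_def)

lemma cross_aisle_subset:
  "i < n_cross I \<Longrightarrow> {0..wh_length I} \<times> {real i * wh_width I / (real (n_cross I) - 1)} \<subseteq> grid I"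
  by (auto simp: grid_def cross_aisles_def)

text \<open>Every point is joined to the corner: along its aisle to the bottom cross-aisle and along
  that one to the left, or along its cross-aisle to the left and down the leftmost aisle.\<close>

lemma joined_origin:
  assumes "p \<in> grid I"
  shows "\<exists>T. joined p (0, 0) T"
proof -
  obtain x y where p: "p = (x, y)" by (cases p)
  have fac: "0 \<le> real i * w / (real n - 1)" "real i * w / (real n - 1) \<le> w"
    if "i < n" "0 \<le> w" for i n :: nat and w :: real
  proof -
    show "0 \<le> real i * w / (real n - 1)" using that by simp
    have "real i \<le> real n - 1" using that by linarith
    then have "real i / (real n - 1) \<le> 1" by (cases "real n - 1 = 0") (auto simp: divide_simps)
    then have "real i / (real n - 1) * w \<le> 1 * w" using that by (intro mult_right_mono) auto
    then show "real i * w / (real n - 1) \<le> w" by simp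
  qed
  have bottom: "{0..wh_length I} \<times> {0} \<subseteq> grid I"
    using cross_aisle_subset[of 0] wh by auto
  have left: "{0} \<times> {0..wh_width I} \<subseteq> grid I"
    using aisle_subset[of 0] wh by auto
  consider i where "i < n_aisles I" "x = real i * wh_length I / (real (n_aisles I) - 1)"
      "y \<in> {0..wh_width I}"
    | i where "i < n_cross I" "y = real i * wh_width I / (real (n_cross I) - 1)"
      "x \<in> {0..wh_length I}"
    using assms by (auto simp: p grid_def aisles_def cross_aisles_def)
  then show ?thesis
  proof cases
    case 1
    have "\<exists>T. joined p (x, 0) T"
      using 1 wh aisle_subset[OF 1(1)]
      by (intro joined_convex[of "{x} \<times> {0..wh_width I}"] convex_Times) (auto simp: p)
    moreover have "\<exists>T. joined (x, 0) (0, 0) T"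
      using 1 fac[OF 1(1) wh(1)] wh bottom
      by (intro joined_convex[of "{0..wh_length I} \<times> {0}"] convex_Times) auto
    ultimately show ?thesis using joined_trans by blast
  next
    case 2
    have "\<exists>T. joined p (0, y) T"
      using 2 wh cross_aisle_subset[OF 2(1)]
      by (intro joined_convex[of "{0..wh_length I} \<times> {y}"] convex_Times) (auto simp: p)
    moreover have "\<exists>T. joined (0, y) (0, 0) T"
      using 2 fac[OF 2(1) wh(2)] wh left
      by (intro joined_convex[of "{0} \<times> {0..wh_width I}"] convex_Times) auto
    ultimately show ?thesis using joined_trans by blast
  qed
qed

lemma joined_ex: "p \<in> grid I \<Longrightarrow> q \<in> grid I \<Longrightarrow> \<exists>T. joined p q T"
  using joined_origin joined_sym joined_trans by meson

lemma compact_grid: "compact (grid I)"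
proof -
  have "aisles I = (\<Union>i<n_aisles I. {real i * wh_length I / (real (n_aisles I) - 1)} \<times> {0..wh_width I})"
    by (auto simp: aisles_def)
  moreover have "cross_aisles I = (\<Union>i<n_cross I. {0..wh_length I} \<times> {real i * wh_width I / (real (n_cross I) - 1)})"
    by (auto simp: cross_aisles_def)
  ultimately show ?thesis
    unfolding grid_def by (auto intro!: compact_Un compact_UN compact_Times)
qed

text \<open>The infimum is attained: by the Arzela-Ascoli theorem, movements whose durations tend to
  the infimum have a uniformly convergent subsequence, and its limit is again a movement.\<close>

lemma gdist_attained:
  assumes pq: "p \<in> grid I" "q \<in> grid I"
  shows "joined p q (gdist I p q)"
proof -
  define m where "m = gdist I p q"
  have ne: "{T. joined p q T} \<noteq> {}" using joined_ex[OF pq] by blast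
  have bdd: "bdd_below {T. joined p q T}" using joined_nonneg by (intro bdd_belowI[of _ 0]) auto
  have m_le: "m \<le> T" if "joined p q T" for T
    using that bdd by (auto simp: m_def gdist_joined intro: cInf_lower)
  have m0: "0 \<le> m"
    unfolding m_def gdist_joined using ne joined_nonneg by (intro cInf_greatest) auto
  have "\<exists>T \<gamma>. movement I 0 T \<gamma> \<and> \<gamma> 0 = p \<and> \<gamma> T = q \<and> T < m + inverse (real (Suc n))" for n
  proof -
    have "Inf {T. joined p q T} < m + inverse (real (Suc n))"
      by (simp add: m_def gdist_joined)
    then obtain T where "joined p q T" "T < m + inverse (real (Suc n))"
      using cInf_lessD[OF ne] by blast
    then show ?thesis unfolding joined_def by blast
  qed
  then obtain T \<gamma> where \<gamma>: "\<And>n. movement I 0 (T n) (\<gamma> n)" "\<And>n. \<gamma> n 0 = p" "\<And>n. \<gamma> n (T n) = q"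
    and T: "\<And>n. T n < m + inverse (real (Suc n))"
    by metis
  have mT: "m \<le> T n" for n
    using m_le \<gamma> joined_def by blast
  have lip: "dist (\<gamma> n x) (\<gamma> n y) \<le> dist x y" if "x \<in> {0..T n}" "y \<in> {0..T n}" for n x y
    using \<gamma>(1)[of n] that lipschitz_onD[of 1 "{0..T n}" "\<gamma> n" x y] by (auto simp: movement_def)
  have on: "\<gamma> n x \<in> grid I" if "x \<in> {0..m}" for n x
    using \<gamma>(1)[of n] that mT[of n] by (auto simp: movement_def image_subset_iff)
  have lipm: "dist (\<gamma> n x) (\<gamma> n y) \<le> dist x y" if "x \<in> {0..m}" "y \<in> {0..m}" for n x y
    using lip[of x n y] that mT[of n] by auto
  obtain M where M: "\<And>x. x \<in> grid I \<Longrightarrow> norm x \<le> M"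
    using compact_imp_bounded[OF compact_grid] by (auto simp: bounded_iff)
  obtain g k where k: "strict_mono (k :: nat \<Rightarrow> nat)"
    and unif: "\<And>e. 0 < e \<Longrightarrow> \<exists>N. \<forall>n x. n \<ge> N \<and> x \<in> {0..m} \<longrightarrow> norm (\<gamma> (k n) x - g x) < e"
  proof (rule Arzela_Ascoli[of "{0..m}" \<gamma> M])
    show "norm (\<gamma> n x) \<le> M" if "x \<in> {0..m}" for n x
      using M on that by blast
    show "\<exists>d. 0 < d \<and> (\<forall>n y. y \<in> {0..m} \<and> norm (x - y) < d \<longrightarrow> norm (\<gamma> n x - \<gamma> n y) < e)"
      if "x \<in> {0..m}" "0 < e" for x e
    proof (intro exI[of _ e] conjI allI impI)
      fix n y assume "y \<in> {0..m} \<and> norm (x - y) < e"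
      then show "norm (\<gamma> n x - \<gamma> n y) < e"
        using lipm[of x y n] that by (simp add: dist_norm)
    qed (use that in auto)
  qed (auto simp: m0)
  have lim: "(\<lambda>n. \<gamma> (k n) x) \<longlonglongrightarrow> g x" if "x \<in> {0..m}" for x
    unfolding LIMSEQ_iff using unif that by blast
  have "dist (g x) (g y) \<le> dist x y" if "x \<in> {0..m}" "y \<in> {0..m}" for x y
  proof (rule LIMSEQ_le_const2)
    show "(\<lambda>n. dist (\<gamma> (k n) x) (\<gamma> (k n) y)) \<longlonglongrightarrow> dist (g x) (g y)"
      using lim that by (intro tendsto_dist) auto
  qed (use lipm that in auto)
  moreover have "g x \<in> grid I" if "x \<in> {0..m}" for x
    using closed_sequentially[OF compact_imp_closed[OF compact_grid] _ lim[OF that]] on that by blast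
  ultimately have mov: "movement I 0 m g"
    using m0 by (auto simp: movement_def lipschitz_on_def)
  have "(\<lambda>n. \<gamma> (k n) 0) \<longlonglongrightarrow> g 0" using lim m0 by auto
  then have g0: "g 0 = p" by (simp add: \<gamma>(2) LIMSEQ_const_iff)
  have "dist (\<gamma> (k n) m) q \<le> inverse (real (Suc (k n)))" for n
    using lip[of m "k n" "T (k n)"] mT[of "k n"] T[of "k n"] m0 \<gamma>(3)[of "k n"]
    by (auto simp: dist_real_def)
  then have "\<forall>\<^sub>F n in sequentially. norm (dist (\<gamma> (k n) m) q) \<le> inverse (real (Suc (k n)))"
    by (simp only: real_norm_def abs_of_nonneg zero_le_dist always_eventually simp_thms)
  then have "(\<lambda>n. dist (\<gamma> (k n) m) q) \<longlonglongrightarrow> 0"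
    by (rule Lim_null_comparison) (rule LIMSEQ_subseq_LIMSEQ[OF LIMSEQ_inverse_real_of_nat k, unfolded o_def])
  then have "(\<lambda>n. \<gamma> (k n) m) \<longlonglongrightarrow> q"
    by (rule tendsto_dist_iff[THEN iffD2])
  then have "g m = q" using lim[of m] m0 by (intro LIMSEQ_unique[of "\<lambda>n. \<gamma> (k n) m"]) auto
  then show ?thesis using mov g0 unfolding m_def joined_def by blast
qed

lemma gdist_le: "joined p q T \<Longrightarrow> gdist I p q \<le> T"
  unfolding gdist_joined using joined_nonneg
  by (intro cInf_lower bdd_belowI[of _ 0]) auto

lemma gdist_nonneg: "p \<in> grid I \<Longrightarrow> q \<in> grid I \<Longrightarrow> 0 \<le> gdist I p q"
  using gdist_attained joined_nonneg by blast

lemma gdist_refl: "p \<in> grid I \<Longrightarrow> gdist I p p = 0"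
  using gdist_le[OF joined_refl] gdist_nonneg by fastforce

lemma gdist_commute: "p \<in> grid I \<Longrightarrow> q \<in> grid I \<Longrightarrow> gdist I p q = gdist I q p"
  using gdist_le[OF joined_sym[OF gdist_attained]] by (meson order_antisym)

lemma gdist_triangle:
  "p \<in> grid I \<Longrightarrow> q \<in> grid I \<Longrightarrow> r \<in> grid I \<Longrightarrow> gdist I p r \<le> gdist I p q + gdist I q r"
  using gdist_le[OF joined_trans[OF gdist_attained gdist_attained]] by blast

lemma gdist_movement: "movement I s t \<gamma> \<Longrightarrow> gdist I (\<gamma> s) (\<gamma> t) \<le> t - s"
  by (intro gdist_le joined_movement)

lemma shortest_movement:
  assumes "p \<in> grid I" "q \<in> grid I"
  obtains \<gamma> where "movement I t (t + gdist I p q) \<gamma>" "\<gamma> t = p" "\<gamma> (t + gdist I p q) = q"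
proof -
  obtain \<gamma> where \<gamma>: "movement I 0 (gdist I p q) \<gamma>" "\<gamma> 0 = p" "\<gamma> (gdist I p q) = q"
    using gdist_attained[OF assms] by (auto simp: joined_def)
  show ?thesis
    using movement_shift[OF \<gamma>(1), of t] \<gamma>(2,3) by (intro that[of "\<lambda>u. \<gamma> (u - t)"]) (auto simp: add.commute)
qed

end

section \<open>Lengths of tours\<close>

fun path_length :: "inst \<Rightarrow> point \<Rightarrow> point list \<Rightarrow> real" where
  "path_length I p [] = 0"
| "path_length I p (q # qs) = gdist I p q + path_length I q qs"

text \<open>The places visited when carrying out a plan. The end of a batch is a place of its own for
  a pushcart only.\<close>

definition tour :: "cart_type \<Rightarrow> inst \<Rightarrow> item list list \<Rightarrow> point list" where
  "tour ct I Bs =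
     concat (map (\<lambda>B. map snd B @ (case ct of Pushcart \<Rightarrow> [depot I] | RobotCart \<Rightarrow> [])) Bs)"

lemma tour_simps [simp]:
  "tour ct I [] = []"
  "tour ct I (B # Bs) =
     map snd B @ (case ct of Pushcart \<Rightarrow> [depot I] | RobotCart \<Rightarrow> []) @ tour ct I Bs"
  "tour ct I (Bs @ Bs') = tour ct I Bs @ tour ct I Bs'"
  by (simp_all add: tour_def)

lemma tour_robot: "tour RobotCart I Bs = map snd (concat Bs)"
  by (simp add: tour_def map_concat)

lemma last_tour_pushcart: "Bs \<noteq> [] \<Longrightarrow> last (p # tour Pushcart I Bs) = depot I"
  by (induction Bs rule: rev_induct) auto

definition finish ::
  "cart_type \<Rightarrow> inst \<Rightarrow> (nat \<Rightarrow> real) \<Rightarrow> real \<Rightarrow> point \<Rightarrow> event list \<Rightarrow> real" where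
  "finish ct I \<rho> t p es = last (t # map fst (timeline ct I \<rho> t p es))"

lemma completion_finish: "completion ct I \<rho> t p Bs = finish ct I \<rho> t p (events Bs)"
  by (simp add: completion_def finish_def)

lemma finish_simps [simp]:
  "finish ct I \<rho> t p [] = t"
  "finish ct I \<rho> t p (Pick x # es) =
     finish ct I \<rho> (max (t + gdist I p (snd x)) (\<rho> (fst x))) (snd x) es"
  "finish ct I \<rho> t p (Close # es) =
     finish ct I \<rho> (t + gdist I p (close_pos ct I p)) (close_pos ct I p) es"
  by (cases x; simp add: finish_def Let_def)+

lemma timeline_Pick:
  "timeline ct I \<rho> t p (Pick x # es) =
     (let t' = max (t + gdist I p (snd x)) (\<rho> (fst x)) in (t', snd x) # timeline ct I \<rho> t' (snd x) es)"
  by (cases x) simp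

lemma events_simps [simp]:
  "events [] = []"
  "events (B # Bs) = map Pick B @ Close # events Bs"
  "events (Bs @ Bs') = events Bs @ events Bs'"
  by (simp_all add: events_def)

lemma set_events: "Pick x \<in> set (events Bs) \<longleftrightarrow> x \<in> set (concat Bs)"
  by (induction Bs) auto

context warehouse
begin

lemma tour_grid: "snd ` set (concat Bs) \<subseteq> grid I \<Longrightarrow> set (tour ct I Bs) \<subseteq> grid I"
  using depot_grid by (auto simp: tour_def split: cart_type.splits)

lemma path_length_append:
  "path_length I p (xs @ ys) = path_length I p xs + path_length I (last (p # xs)) ys"
  by (induction xs arbitrary: p) auto

lemma path_length_nonneg: "p \<in> grid I \<Longrightarrow> set xs \<subseteq> grid I \<Longrightarrow> 0 \<le> path_length I p xs"
  by (induction xs arbitrary: p) (auto simp: gdist_nonneg)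

lemma path_length_detour:
  "p \<in> grid I \<Longrightarrow> q \<in> grid I \<Longrightarrow> set xs \<subseteq> grid I \<Longrightarrow>
     path_length I p xs \<le> gdist I p q + path_length I q xs"
  by (cases xs) (auto simp: gdist_nonneg dest: gdist_triangle[of p q])

text \<open>By the triangle inequality, skipping stops does not make a path longer. All upper bounds on
  tours below come from recognizing the stops of one plan as a subsequence of those of others.\<close>

lemma path_length_subseq:
  "subseq xs ys \<Longrightarrow> p \<in> grid I \<Longrightarrow> set ys \<subseteq> grid I \<Longrightarrow> path_length I p xs \<le> path_length I p ys"
proof (induction ys arbitrary: p xs)
  case (Cons y ys)
  show ?case
  proof (cases "xs \<noteq> [] \<and> hd xs = y")
    case True
    then obtain xs' where "xs = y # xs'" by (cases xs) auto
    then show ?thesis using Cons by simp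
  next
    case False
    then have sub: "subseq xs ys" using Cons.prems(1) by (cases xs) auto
    have "set xs \<subseteq> grid I" 
      using sub Cons.prems(3) by (metis subseq_conv_nths set_nths_subset list.set(2) subset_insertI order_trans)
    then have "path_length I p xs \<le> gdist I p y + path_length I y xs"
      using Cons.prems by (intro path_length_detour) auto
    also have "\<dots> \<le> gdist I p y + path_length I y ys"
      using Cons.IH[OF sub] Cons.prems by auto
    finally show ?thesis by simp
  qed
next
  case Nil
  then show ?case by (cases xs) auto
qed

lemma path_length_return:
  "p \<in> grid I \<Longrightarrow> set xs \<subseteq> grid I \<Longrightarrow> path_length I p (xs @ rev xs @ [p]) = 2 * path_length I p xs"
proof (induction xs arbitrary: p)
  case (Cons x xs)
  have "path_length I p ((x # xs) @ rev (x # xs) @ [p])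
      = gdist I p x + path_length I x (xs @ rev xs @ [x]) + gdist I x p"
    using path_length_append[of x "xs @ rev xs @ [x]" "[p]"] by simp
  then show ?case using Cons gdist_commute[of x p] by simp
qed (simp add: gdist_refl)

lemma close_pos_grid: "p \<in> grid I \<Longrightarrow> close_pos ct I p \<in> grid I"
  using depot_grid by (cases ct) (auto simp: close_pos_def)

text \<open>Carrying out picks takes at least the length of their tour and cannot end
  before the last of their orders has arrived; if there is no waiting for arrivals, the length is exact.\<close>

lemma finish_picks:
  assumes "p \<in> grid I" "snd ` set B \<subseteq> grid I"
  shows "\<exists>t'. t + path_length I p (map snd B) \<le> t' \<and> (\<forall>x\<in>set B. \<rho> (fst x) \<le> t') \<and>
     ((\<forall>j. \<rho> j \<le> t) \<longrightarrow> t' = t + path_length I p (map snd B)) \<and>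
     finish ct I \<rho> t p (map Pick B @ es) = finish ct I \<rho> t' (last (p # map snd B)) es"
  using assms
proof (induction B arbitrary: t p)
  case (Cons x B)
  define u where "u = max (t + gdist I p (snd x)) (\<rho> (fst x))"
  have g: "0 \<le> gdist I p (snd x)" "0 \<le> path_length I (snd x) (map snd B)"
    using Cons.prems gdist_nonneg[of p "snd x"] path_length_nonneg[of "snd x" "map snd B"] by auto
  obtain t' where t': "u + path_length I (snd x) (map snd B) \<le> t'" "\<forall>x\<in>set B. \<rho> (fst x) \<le> t'"
    "(\<forall>j. \<rho> j \<le> u) \<longrightarrow> t' = u + path_length I (snd x) (map snd B)"
    "finish ct I \<rho> u (snd x) (map Pick B @ es) = finish ct I \<rho> t' (last (snd x # map snd B)) es"
    using Cons.IH[of "snd x" u] Cons.prems by auto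
  have "u = t + gdist I p (snd x)" "\<forall>j. \<rho> j \<le> u" if "\<forall>j. \<rho> j \<le> t"
  proof -
    have le: "\<rho> j \<le> t + gdist I p (snd x)" for j using that g by (simp add: add_increasing2)
    then show "u = t + gdist I p (snd x)" using le[of "fst x"] by (simp add: u_def max_absorb1)
    with le show "\<forall>j. \<rho> j \<le> u" by simp
  qed
  moreover have "t + gdist I p (snd x) \<le> u" "\<rho> (fst x) \<le> u" by (simp_all add: u_def)
  ultimately show ?case
    using t' g by (intro exI[of _ t']) (auto simp flip: u_def)
next
  case Nil
  show ?case by (rule exI[of _ t]) simp
qed

lemma finish_batches:
  assumes "p \<in> grid I" "snd ` set (concat Bs) \<subseteq> grid I"
  shows "\<exists>t'. t + path_length I p (tour ct I Bs) \<le> t' \<and>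
     (\<forall>x\<in>set (concat Bs). \<rho> (fst x) \<le> t') \<and>
     ((\<forall>j. \<rho> j \<le> t) \<longrightarrow> t' = t + path_length I p (tour ct I Bs)) \<and>
     finish ct I \<rho> t p (events Bs @ es) = finish ct I \<rho> t' (last (p # tour ct I Bs)) es"
  using assms
proof (induction Bs arbitrary: t p)
  case (Cons B Bs)
  define q where "q = last (p # map snd B)"
  define q' where "q' = close_pos ct I q"
  have q: "q \<in> grid I" "q' \<in> grid I"
  proof -
    have "q \<in> set (p # map snd B)" unfolding q_def by (rule last_in_set) simp
    then show "q \<in> grid I" using Cons.prems by auto
    then show "q' \<in> grid I" by (simp add: q'_def close_pos_grid)
  qed
  have len: "path_length I p (tour ct I (B # Bs))
      = path_length I p (map snd B) + gdist I q q' + path_length I q' (tour ct I Bs)"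
    using q by (cases ct) (auto simp: path_length_append q_def q'_def close_pos_def gdist_refl)
  have last: "last (p # tour ct I (B # Bs)) = last (q' # tour ct I Bs)"
    by (cases ct) (auto simp: q_def q'_def close_pos_def)
  have nonneg: "0 \<le> gdist I q q'" "0 \<le> path_length I p (map snd B)"
      "0 \<le> path_length I q' (tour ct I Bs)"
    using q Cons.prems gdist_nonneg[of q q'] path_length_nonneg[of p "map snd B"]
      path_length_nonneg[of q' "tour ct I Bs"] tour_grid[of Bs ct]
    by (simp_all add: image_Un)
  obtain u where u: "t + path_length I p (map snd B) \<le> u" "\<forall>x\<in>set B. \<rho> (fst x) \<le> u"
    "(\<forall>j. \<rho> j \<le> t) \<longrightarrow> u = t + path_length I p (map snd B)"
    "finish ct I \<rho> t p (map Pick B @ Close # events Bs @ es)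
     = finish ct I \<rho> u q (Close # events Bs @ es)"
    using finish_picks[of p B t \<rho> ct "Close # events Bs @ es"] Cons.prems by (auto simp: q_def)
  define v where "v = u + gdist I q q'"
  obtain t' where t': "v + path_length I q' (tour ct I Bs) \<le> t'"
    "\<forall>x\<in>set (concat Bs). \<rho> (fst x) \<le> t'"
    "(\<forall>j. \<rho> j \<le> v) \<longrightarrow> t' = v + path_length I q' (tour ct I Bs)"
    "finish ct I \<rho> v q' (events Bs @ es) = finish ct I \<rho> t' (last (q' # tour ct I Bs)) es"
    using Cons.IH[of q' v] Cons.prems q by auto
  have "finish ct I \<rho> t p (events (B # Bs) @ es)
      = finish ct I \<rho> t' (last (p # tour ct I (B # Bs))) es"
    unfolding last using u(4) t'(4) by (simp add: q'_def v_def)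
  moreover have "t + path_length I p (tour ct I (B # Bs)) \<le> t'"
    using len u(1) t'(1) by (simp add: v_def)
  moreover have "\<forall>x\<in>set (concat (B # Bs)). \<rho> (fst x) \<le> t'"
    using u(2) t'(1,2) nonneg by (fastforce simp: v_def)
  moreover have "t' = t + path_length I p (tour ct I (B # Bs))" if "\<forall>j. \<rho> j \<le> t"
  proof -
    have "u = t + path_length I p (map snd B)" using u(3) that by blast
    moreover from this have "\<forall>j. \<rho> j \<le> v" using that nonneg
      by (auto simp: v_def intro: order_trans)
    ultimately show ?thesis using t'(3) len by (simp add: v_def)
  qed
  ultimately show ?case by blast
next
  case Nil
  show ?case by (rule exI[of _ t]) simp
qed

lemma completion_immediate:
  assumes "p \<in> grid I" "snd ` set (concat Bs) \<subseteq> grid I"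
  shows "completion ct I (\<lambda>_. t) t p Bs = t + path_length I p (tour ct I Bs)"
  using finish_batches[OF assms, of t ct "\<lambda>_. t" "[]"] by (auto simp: completion_finish)

lemma completion_ge_length:
  assumes "p \<in> grid I" "snd ` set (concat Bs) \<subseteq> grid I"
  shows "t + path_length I p (tour ct I Bs) \<le> completion ct I \<rho> t p Bs"
  using finish_batches[OF assms, of t ct \<rho> "[]"] by (auto simp: completion_finish)

lemma completion_ge_arrival:
  assumes "p \<in> grid I" "snd ` set (concat Bs) \<subseteq> grid I" "x \<in> set (concat Bs)"
  shows "\<rho> (fst x) \<le> completion ct I \<rho> t p Bs"
proof -
  obtain t' where "\<forall>x\<in>set (concat Bs). \<rho> (fst x) \<le> t'" "completion ct I \<rho> t p Bs = t'"
    using finish_batches[OF assms(1,2), of t ct \<rho> "[]"] by (auto simp: completion_finish)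
  then show ?thesis using assms(3) by auto
qed

text \<open>After any pick, which happens no earlier than the arrival of its order, the picker still
  has to travel along the rest of the tour.\<close>

lemma completion_ge_rest:
  assumes "p \<in> grid I" "snd ` set (concat (Bs @ (B @ x # B') # Bs')) \<subseteq> grid I"
  shows "\<rho> (fst x) + path_length I (snd x) (tour ct I (B' # Bs'))
      \<le> completion ct I \<rho> t p (Bs @ (B @ x # B') # Bs')"
proof -
  have in_grid: "snd ` set (concat Bs) \<subseteq> grid I" "snd ` set B \<subseteq> grid I" "snd x \<in> grid I"
    "snd ` set (concat (B' # Bs')) \<subseteq> grid I"
    using assms(2) by auto
  define q where "q = last (p # tour ct I Bs)"
  have "q \<in> set (p # tour ct I Bs)" unfolding q_def by (rule last_in_set) simp
  then have q: "q \<in> grid I" using assms(1) tour_grid[OF in_grid(1), of ct] by auto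
  have ev: "events (Bs @ (B @ x # B') # Bs')
      = events Bs @ map Pick B @ Pick x # events (B' # Bs')"
    by simp
  obtain u where u: "completion ct I \<rho> t p (Bs @ (B @ x # B') # Bs')
      = finish ct I \<rho> u q (map Pick B @ Pick x # events (B' # Bs'))"
    using finish_batches[OF assms(1) in_grid(1), of t ct \<rho> "map Pick B @ Pick x # events (B' # Bs')"]
    unfolding completion_finish ev q_def by auto
  obtain v where v: "completion ct I \<rho> t p (Bs @ (B @ x # B') # Bs')
      = finish ct I \<rho> v (last (q # map snd B)) (Pick x # events (B' # Bs'))"
    using finish_picks[OF q in_grid(2), of u \<rho> ct "Pick x # events (B' # Bs')"] unfolding u by blast
  define w where "w = max (v + gdist I (last (q # map snd B)) (snd x)) (\<rho> (fst x))"
  have "completion ct I \<rho> t p (Bs @ (B @ x # B') # Bs') = completion ct I \<rho> w (snd x) (B' # Bs')"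
    unfolding v unfolding completion_finish w_def by (simp only: finish_simps)
  moreover have "w + path_length I (snd x) (tour ct I (B' # Bs')) \<le> completion ct I \<rho> w (snd x) (B' # Bs')"
    using completion_ge_length[OF in_grid(3,4)] .
  moreover have "\<rho> (fst x) \<le> w" by (simp add: w_def)
  ultimately show ?thesis by linarith
qed

section \<open>Existence of optimal plans\<close>

text \<open>A tie-breaking rule is bound to return an optimal plan only in situations in which one exists,
  and part of an optimal plan is a movement that meets its timeline. So before anything can be said
  about what a rule returns, existence has to be established: there are finitely many plans, and
  shortest movements can be joined along the timeline of each of them.\<close>

lemma timeline_ge:
  "p \<in> grid I \<Longrightarrow> (\<And>x. Pick x \<in> set es \<Longrightarrow> snd x \<in> grid I) \<Longrightarrow>
     (u, q) \<in> set (timeline ct I \<rho> t p es) \<Longrightarrow> t \<le> u"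
proof (induction es arbitrary: t p)
  case (Cons e es)
  show ?case
  proof (cases e)
    case (Pick x)
    have "0 \<le> gdist I p (snd x)"
      using Cons.prems(1) Cons.prems(2)[of x] Pick by (simp add: gdist_nonneg)
    moreover have "u = max (t + gdist I p (snd x)) (\<rho> (fst x)) \<or>
        (u, q) \<in> set (timeline ct I \<rho> (max (t + gdist I p (snd x)) (\<rho> (fst x))) (snd x) es)"
      using Cons.prems(3) by (auto simp only: Pick timeline_Pick Let_def list.set insert_iff prod.inject)
    then have "max (t + gdist I p (snd x)) (\<rho> (fst x)) \<le> u"
      using Cons.IH[of "snd x"] Cons.prems(2) Pick by (metis list.set_intros order_refl)
    ultimately show ?thesis by linarith
  next
    case Close
    have c: "close_pos ct I p \<in> grid I" using Cons.prems(1) by (rule close_pos_grid)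
    then have "0 \<le> gdist I p (close_pos ct I p)" using Cons.prems by (auto intro: gdist_nonneg)
    moreover have "u = t + gdist I p (close_pos ct I p) \<or> t + gdist I p (close_pos ct I p) \<le> u"
      using Cons.prems Cons.IH[OF c] Close by (auto simp: Let_def)
    ultimately show ?thesis by linarith
  qed
qed simp

lemma movement_ex:
  assumes "p \<in> grid I" "\<And>x. Pick x \<in> set es \<Longrightarrow> snd x \<in> grid I" "t0 \<le> t"
  shows "\<exists>\<gamma>. movement I t (finish ct I (\<lambda>_. t0) t p es) \<gamma> \<and> \<gamma> t = p \<and>
     (\<forall>(u, q) \<in> set (timeline ct I (\<lambda>_. t0) t p es). \<gamma> u = q)"
  using assms
proof (induction es arbitrary: t p)
  case Nil
  then show ?case by (auto intro!: exI[of _ "\<lambda>_. p"] movement_const)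
next
  case (Cons e es)
  define q where "q = (case e of Pick x \<Rightarrow> snd x | Close \<Rightarrow> close_pos ct I p)"
  have q: "q \<in> grid I" using Cons.prems by (auto simp: q_def close_pos_grid split: event.splits)
  define t' where "t' = t + gdist I p q"
  have t': "t \<le> t'" using gdist_nonneg[OF Cons.prems(1) q] by (simp add: t'_def)
  have max: "max t' t0 = t'" using t' Cons.prems(3) by simp
  have fin: "finish ct I (\<lambda>_. t0) t p (e # es) = finish ct I (\<lambda>_. t0) t' q es"
    using max by (cases e) (simp_all add: q_def t'_def)
  have tl: "timeline ct I (\<lambda>_. t0) t p (e # es) = (t', q) # timeline ct I (\<lambda>_. t0) t' q es"
    using max by (cases e) (simp_all add: timeline_Pick q_def t'_def Let_def)
  obtain \<gamma> where \<gamma>: "movement I t t' \<gamma>" "\<gamma> t = p" "\<gamma> t' = q"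
    using shortest_movement[OF Cons.prems(1) q, of t] by (auto simp: t'_def)
  obtain \<delta> where \<delta>: "movement I t' (finish ct I (\<lambda>_. t0) t' q es) \<delta>" "\<delta> t' = q"
    "\<And>u r. (u, r) \<in> set (timeline ct I (\<lambda>_. t0) t' q es) \<Longrightarrow> \<delta> u = r"
    using Cons.IH[OF q, of t'] Cons.prems t' by fastforce
  define \<eta> where "\<eta> = (\<lambda>u. if u \<le> t' then \<gamma> u else \<delta> u)"
  have "movement I t (finish ct I (\<lambda>_. t0) t' q es) \<eta>"
    unfolding \<eta>_def using \<gamma> \<delta> by (intro movement_join) auto
  moreover have "\<eta> t = p" "\<eta> t' = q" using t' \<gamma> by (auto simp: \<eta>_def)
  moreover have "\<eta> u = r" if "(u, r) \<in> set (timeline ct I (\<lambda>_. t0) t' q es)" for u r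
  proof -
    have "t' \<le> u" using timeline_ge[OF q _ that] Cons.prems(2) by auto
    then show ?thesis using \<delta> that \<open>\<eta> t' = q\<close> by (cases "u = t'") (auto simp: \<eta>_def)
  qed
  ultimately show ?case unfolding fin tl by (intro exI[of _ \<eta>]) auto
qed

lemma finite_feasible:
  assumes "finite (items I)"
  shows "finite {Bs. feasible I st Bs}"
proof (rule finite_subset)
  define A where "A = items I"
  define L where "L = {B. set B \<subseteq> A \<and> length B \<le> card A}"
  show "finite {Bs. set Bs \<subseteq> L \<and> length Bs \<le> Suc (card A)}"
    using assms by (intro finite_lists_length_le) (simp add: A_def L_def finite_lists_length_le)
  have "set Bs \<subseteq> L \<and> length Bs \<le> Suc (card A)" if "feasible I st Bs" for Bs
  proof
    have dist: "distinct (concat Bs)" and sub: "set (concat Bs) \<subseteq> A"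
      using that by (auto simp: feasible_def A_def)
    have len: "length (concat Bs) \<le> card A"
      using distinct_card[OF dist] card_mono[OF _ sub] assms by (simp add: A_def)
    show "set Bs \<subseteq> L"
    proof
      fix B assume B: "B \<in> set Bs"
      have "length B \<le> length (concat Bs)"
        using B by (auto simp: length_concat intro!: member_le_sum_list)
      then show "B \<in> L" using B sub len by (auto simp: L_def)
    qed
    \<comment> \<open>Only the first batch may be empty, namely when it finishes a batch in progress.\<close>
    have "B \<noteq> []" if "B \<in> set (tl Bs)" for B
    proof -
      obtain i where "i < length (tl Bs)" "B = tl Bs ! i"
        using \<open>B \<in> set (tl Bs)\<close> by (auto simp: in_set_conv_nth)
      then have "batch_orders st Bs (Suc i) = fst ` set B" "Suc i < length Bs"
        by (auto simp: batch_orders_def nth_tl)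
      then show ?thesis using \<open>feasible I st Bs\<close> by (auto simp: feasible_def)
    qed
    moreover have "length Cs \<le> length (concat Cs)" if "\<And>B. B \<in> set Cs \<Longrightarrow> B \<noteq> []" for Cs :: "item list list"
      using that
    proof (induction Cs)
      case (Cons C Cs)
      then have "0 < length C" "length Cs \<le> length (concat Cs)" by auto
      then show ?case by (simp del: length_greater_0_conv)
    qed simp
    ultimately have "length (tl Bs) \<le> length (concat (tl Bs))" by blast
    then show "length Bs \<le> Suc (card A)" using len by (cases Bs) auto
  qed
  then show "{Bs. feasible I st Bs} \<subseteq> {Bs. set Bs \<subseteq> L \<and> length Bs \<le> Suc (card A)}" by auto
qed

lemma optimal_plan_ex:
  assumes "finite (items I)" "snd ` items I \<subseteq> grid I" "pos st \<in> grid I" "feasible I st Bs"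
  shows "\<exists>P. optimal_plan ct I t st P"
proof -
  let ?c = "\<lambda>Bs. completion ct I (\<lambda>_. t) t (pos st) Bs"
  let ?F = "{Bs. feasible I st Bs}"
  have "finite ?F" "?F \<noteq> {}" using finite_feasible assms(1,4) by auto
  then obtain Bs where Bs: "feasible I st Bs" "\<And>Bs'. feasible I st Bs' \<Longrightarrow> ?c Bs \<le> ?c Bs'"
    using ex_is_arg_min_if_finite[of ?F ?c] by (auto simp: is_arg_min_linorder)
  have "snd x \<in> grid I" if "Pick x \<in> set (events Bs)" for x
    using that Bs(1) assms(2) by (auto simp: set_events feasible_def simp del: set_concat)
  then obtain \<gamma> where "route ct I t st Bs \<gamma>"
    using movement_ex[OF assms(3), of "events Bs" t t ct] by (auto simp: route_def completion_finish)
  then show ?thesis using Bs unfolding optimal_plan_def by auto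
qed

end

section \<open>Feasible plans\<close>

text \<open>The part of feasibility that does not refer to an instance. Unlike feasibility itself, it is
  inherited by parts of a plan and can be established for plans put together from others.\<close>

definition batching :: "nat \<Rightarrow> item list list \<Rightarrow> bool" where
  "batching c Bs \<longleftrightarrow> distinct (concat Bs) \<and> (\<forall>B \<in> set Bs. B \<noteq> [] \<and> card (fst ` set B) \<le> c) \<and>
     sorted_wrt (\<lambda>B B'. fst ` set B \<inter> fst ` set B' = {}) Bs"

lemma pairwise_nth_iff_sorted_wrt:
  assumes "\<And>x y. P x y \<Longrightarrow> P y x"
  shows "(\<forall>i < length xs. \<forall>j < length xs. i \<noteq> j \<longrightarrow> P (xs ! i) (xs ! j)) \<longleftrightarrow> sorted_wrt P xs"
proof
  assume s: "sorted_wrt P xs"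
  show "\<forall>i < length xs. \<forall>j < length xs. i \<noteq> j \<longrightarrow> P (xs ! i) (xs ! j)"
  proof (intro allI impI)
    fix i j assume "i < length xs" "j < length xs" "i \<noteq> j"
    then show "P (xs ! i) (xs ! j)"
      using s assms by (cases i j rule: linorder_cases) (auto simp: sorted_wrt_iff_nth_less)
  qed
qed (auto simp: sorted_wrt_iff_nth_less)

lemma feasible_empty_cart:
  assumes "cart st = {}"
  shows "feasible I st Bs \<longleftrightarrow> batching (capacity I) Bs \<and> set (concat Bs) = items I - picked st"
proof -
  have "batch_orders st Bs i = fst ` set (Bs ! i)" for i
    using assms by (simp add: batch_orders_def)
  moreover have "(\<forall>i < length Bs. \<forall>j < length Bs. i \<noteq> j \<longrightarrow>
        fst ` set (Bs ! i) \<inter> fst ` set (Bs ! j) = {}) \<longleftrightarrow>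
      sorted_wrt (\<lambda>B B'. fst ` set B \<inter> fst ` set B' = {}) Bs"
    by (rule pairwise_nth_iff_sorted_wrt) blast
  ultimately show ?thesis
    using assms by (auto simp: feasible_def batching_def all_set_conv_all_nth)
qed

lemma feasible_nonempty_cart:
  assumes "cart st \<noteq> {}" "batching (capacity I) R" "distinct F" "set F \<inter> set (concat R) = {}"
    "set F \<union> set (concat R) = items I - picked st" "card (cart st \<union> fst ` set F) \<le> capacity I"
    "(cart st \<union> fst ` set F) \<inter> fst ` set (concat R) = {}"
  shows "feasible I st (F # R)"
proof -
  have first: "batch_orders st (F # R) 0 = fst ` set F \<union> cart st"
    and rest: "batch_orders st (F # R) (Suc i) = fst ` set (R ! i)" for i
    by (simp_all add: batch_orders_def)
  have "(\<forall>i < length R. \<forall>j < length R. i \<noteq> j \<longrightarrow> fst ` set (R ! i) \<inter> fst ` set (R ! j) = {})"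
    using assms(2) by (subst pairwise_nth_iff_sorted_wrt) (auto simp: batching_def)
  moreover have "(fst ` set F \<union> cart st) \<inter> fst ` set (R ! i) = {}" if "i < length R" for i
    using assms(7) nth_mem[OF that] by auto
  ultimately have "batch_orders st (F # R) i \<inter> batch_orders st (F # R) j = {}"
    if "i < length (F # R)" "j < length (F # R)" "i \<noteq> j" for i j
    using that by (cases i; cases j) (simp_all add: first rest Int_commute)
  moreover have "batch_orders st (F # R) i \<noteq> {} \<and> card (batch_orders st (F # R) i) \<le> capacity I"
    if "i < length (F # R)" for i
    using that assms(1,2,6) by (cases i) (auto simp: first rest Un_commute batching_def)
  ultimately show ?thesis
    using assms unfolding feasible_def by (auto simp: batching_def)
qed

lemma batching_append:
  assumes "batching c Bs" "batching c Bs'" "fst ` set (concat Bs) \<inter> fst ` set (concat Bs') = {}"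
  shows "batching c (Bs @ Bs')"
  using assms by (auto simp: batching_def sorted_wrt_append)

lemma batching_rev: "batching c (rev Bs) \<longleftrightarrow> batching c Bs"
  by (simp add: batching_def sorted_wrt_rev Int_commute)

lemma batching_ConsD:
  "batching c (B # Bs) \<Longrightarrow> batching c Bs \<and> set B \<inter> set (concat Bs) = {}"
  by (auto simp: batching_def)

text \<open>Leaving out items of a plan: batches that become empty disappear.\<close>

definition restrict_plan :: "(item \<Rightarrow> bool) \<Rightarrow> item list list \<Rightarrow> item list list" where
  "restrict_plan Q Bs = filter (\<lambda>B. B \<noteq> []) (map (filter Q) Bs)"

lemma restrict_plan_simps [simp]:
  "restrict_plan Q [] = []"
  "restrict_plan Q (B # Bs) = (if filter Q B = [] then restrict_plan Q Bs else filter Q B # restrict_plan Q Bs)"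
  "restrict_plan Q (Bs @ Bs') = restrict_plan Q Bs @ restrict_plan Q Bs'"
  by (simp_all add: restrict_plan_def)

lemma concat_restrict: "concat (restrict_plan Q Bs) = filter Q (concat Bs)"
  by (induction Bs) auto

lemma set_restrict: "set (concat (restrict_plan Q Bs)) = {x \<in> set (concat Bs). Q x}"
  unfolding concat_restrict by simp

lemma batching_restrict:
  assumes "batching c Bs"
  shows "batching c (restrict_plan Q Bs)"
proof -
  have "card (fst ` set (filter Q B)) \<le> c" if "card (fst ` set B) \<le> c" for B
    using that card_mono[of "fst ` set B" "fst ` set (filter Q B)"] by fastforce
  then have "\<forall>B \<in> set (restrict_plan Q Bs). B \<noteq> [] \<and> card (fst ` set B) \<le> c"
    using assms by (auto simp: restrict_plan_def batching_def)
  moreover have "distinct (concat (restrict_plan Q Bs))"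
    using assms unfolding concat_restrict by (simp add: batching_def)
  moreover have "sorted_wrt (\<lambda>B B'. fst ` set B \<inter> fst ` set B' = {}) (map (filter Q) Bs)"
    unfolding sorted_wrt_map
    by (rule sorted_wrt_mono_rel[of _ "\<lambda>B B'. fst ` set B \<inter> fst ` set B' = {}"])
      (use assms in \<open>auto simp: batching_def\<close>)
  ultimately show ?thesis
    unfolding batching_def by (auto simp: restrict_plan_def intro: sorted_wrt_filter)
qed

lemma subseq_tour_restrict: "subseq (tour ct I (restrict_plan Q Bs)) (tour ct I Bs)"
proof (induction Bs)
  case (Cons B Bs)
  have "subseq (map snd (filter Q B)) (map snd B)" by (intro subseq_map subseq_filter_left)
  then show ?case using Cons by (auto intro: list_emb_append_mono subseq_drop_many list_emb_append_mono[OF list_emb_refl])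
qed simp

lemma subseq_picks_tour: "subseq (map snd (filter Q (concat Bs))) (tour ct I Bs)"
proof (induction Bs)
  case (Cons B Bs)
  have "subseq (map snd (filter Q B)) (map snd B)" by (intro subseq_map subseq_filter_left)
  then show ?case using Cons by (auto intro: list_emb_append_mono subseq_drop_many)
qed simp

lemma subseq_rev: "subseq xs ys \<Longrightarrow> subseq (rev xs) (rev ys)"
  by (induction rule: list_emb.induct) (auto intro: list_emb_append_mono subseq_rev_drop_many)

lemma subseq_picks_home:
  assumes "Bs \<noteq> []"
  shows "subseq (map snd (filter Q (concat Bs)) @ [depot I]) (tour Pushcart I Bs)"
proof -
  obtain Cs C where Bs: "Bs = Cs @ [C]" using assms by (metis rev_exhaust)
  have "subseq (map snd (filter Q C)) (map snd C)" by (intro subseq_map subseq_filter_left)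
  then have "subseq (map snd (filter Q (concat Cs)) @ map snd (filter Q C) @ [depot I])
      (tour Pushcart I Cs @ map snd C @ [depot I])"
    by (intro list_emb_append_mono subseq_picks_tour) auto
  then show ?thesis by (simp add: Bs)
qed

text \<open>How a picker in the middle of a batch can make use of a plan for all orders: the
  remaining items of the orders in the cart are picked first, in the order of the plan, and the
  others in a second pass. A robot picker, who does not return to the depot between the passes,
  makes the second one backwards.\<close>

definition resume :: "cart_type \<Rightarrow> state \<Rightarrow> item list list \<Rightarrow> item list list" where
  "resume ct st Bs =
     (let F = filter (\<lambda>x. x \<notin> picked st \<and> fst x \<in> cart st) (concat Bs);
          R = restrict_plan (\<lambda>x. x \<notin> picked st \<and> fst x \<notin> cart st) Bs;
          R' = (case ct of Pushcart \<Rightarrow> R | RobotCart \<Rightarrow> rev (map rev R))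
      in if cart st = {} then R' else F # R')"

lemma batching_map_rev: "batching c (map rev Bs) \<longleftrightarrow> batching c Bs"
proof -
  have "distinct (concat (map rev Bs)) \<longleftrightarrow> distinct (concat Bs)"
    by (induction Bs) auto
  then show ?thesis by (simp add: batching_def sorted_wrt_map)
qed

text \<open>The first batch consists of the orders in the cart alone, so that it respects the capacity. The
  others are parts of batches of \<open>Bs\<close>.\<close>

lemma feasible_resume:
  assumes "batching (capacity I) Bs" "set (concat Bs) = items I"
    and "finite (cart st)" "card (cart st) \<le> capacity I"
  shows "feasible I st (resume ct st Bs)"
proof -
  define F where "F = filter (\<lambda>x. x \<notin> picked st \<and> fst x \<in> cart st) (concat Bs)"
  define R where "R = restrict_plan (\<lambda>x. x \<notin> picked st \<and> fst x \<notin> cart st) Bs"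
  define R' where "R' = (case ct of Pushcart \<Rightarrow> R | RobotCart \<Rightarrow> rev (map rev R))"
  have R'_batching: "batching (capacity I) R'"
    using batching_restrict[OF assms(1)]
    by (simp add: R'_def R_def batching_rev batching_map_rev split: cart_type.split)
  have "set (concat R) = {x \<in> items I. x \<notin> picked st \<and> fst x \<notin> cart st}"
    unfolding R_def set_restrict assms(2) ..
  moreover have "set (concat R') = set (concat R)"
    by (auto simp: R'_def split: cart_type.splits)
  ultimately have R'_set: "set (concat R') = {x \<in> items I. x \<notin> picked st \<and> fst x \<notin> cart st}"
    by simp
  have F_set: "set F = {x \<in> items I. x \<notin> picked st \<and> fst x \<in> cart st}"
    unfolding F_def set_filter assms(2) ..
  have "feasible I st R'" if "cart st = {}"
    using R'_batching R'_set that by (auto simp: feasible_empty_cart simp del: set_concat)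
  moreover have "feasible I st (F # R')" if "cart st \<noteq> {}"
  proof (rule feasible_nonempty_cart[OF that R'_batching])
    show "distinct F" using assms(1) by (simp add: F_def batching_def)
    have F_cart: "cart st \<union> fst ` set F = cart st" using F_set by auto
    show "card (cart st \<union> fst ` set F) \<le> capacity I" unfolding F_cart by (rule assms(4))
    show "(cart st \<union> fst ` set F) \<inter> fst ` set (concat R') = {}"
      unfolding F_cart R'_set by auto
  qed (unfold F_set R'_set, auto)
  ultimately show ?thesis
    unfolding resume_def Let_def F_def[symmetric] R_def[symmetric] R'_def[symmetric] by simp
qed

text \<open>The stops on the way are among those on the tour for \<open>Bs\<close> made twice by a pushcart, which is
  back at the depot in between, and there and back by a robot picker.\<close>

lemma (in warehouse) path_length_resume:
  assumes "p \<in> grid I" "snd ` set (concat Bs) \<subseteq> grid I" "Bs \<noteq> []"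
  shows "path_length I p (tour ct I (resume ct st Bs))
      \<le> gdist I p (depot I) + 2 * path_length I (depot I) (tour ct I Bs)"
proof -
  define T where "T = tour ct I Bs"
  define F where "F = filter (\<lambda>x. x \<notin> picked st \<and> fst x \<in> cart st) (concat Bs)"
  define R where "R = restrict_plan (\<lambda>x. x \<notin> picked st \<and> fst x \<notin> cart st) Bs"
  have T: "set T \<subseteq> grid I" unfolding T_def using assms(2) by (rule tour_grid)
  have "\<exists>T'. set T' \<subseteq> grid I \<and> path_length I (depot I) T' = 2 * path_length I (depot I) T \<and>
      subseq (tour ct I (resume ct st Bs)) T'"
  proof (cases ct)
    case Pushcart
    have R: "subseq (tour ct I R) T" by (simp add: R_def T_def subseq_tour_restrict)
    have F: "subseq (map snd F @ [depot I]) T"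
      using assms(3) by (simp add: F_def T_def Pushcart subseq_picks_home)
    have "subseq (tour ct I (resume ct st Bs)) (T @ T)"
    proof (cases "cart st = {}")
      case True
      then show ?thesis using R Pushcart by (simp add: resume_def R_def subseq_drop_many)
    next
      case False
      then show ?thesis
        using list_emb_append_mono[OF F R] Pushcart by (simp add: resume_def F_def R_def)
    qed
    moreover have "path_length I (depot I) (T @ T) = 2 * path_length I (depot I) T"
      using last_tour_pushcart[OF assms(3), of "depot I" I]
      by (simp add: path_length_append T_def Pushcart del: last.simps)
    ultimately show ?thesis using T by (intro exI[of _ "T @ T"]) auto
  next
    case RobotCart
    have "subseq (map snd (concat R)) T"
      unfolding R_def concat_restrict T_def by (rule subseq_picks_tour)
    then have "subseq (rev (map snd (concat R))) (rev T)"
      by (simp add: subseq_rev)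
    moreover have "tour ct I (rev (map rev R)) = rev (map snd (concat R))"
      by (simp add: RobotCart tour_robot rev_concat rev_map)
    ultimately have R: "subseq (tour ct I (rev (map rev R))) (rev T @ [depot I])"
      by (simp add: subseq_rev_drop_many)
    have F: "subseq (map snd F) T" by (simp add: F_def T_def subseq_picks_tour del: filter_concat)
    have "subseq (tour ct I (resume ct st Bs)) (T @ rev T @ [depot I])"
    proof (cases "cart st = {}")
      case True
      then show ?thesis using R RobotCart by (simp add: resume_def R_def subseq_drop_many)
    next
      case False
      then show ?thesis
        using list_emb_append_mono[OF F R] RobotCart by (simp add: resume_def F_def R_def)
    qed
    then show ?thesis
      using T depot_grid path_length_return[OF depot_grid T]
      by (intro exI[of _ "T @ rev T @ [depot I]"]) auto
  qed
  then obtain T' where T': "set T' \<subseteq> grid I" "path_length I (depot I) T' = 2 * path_length I (depot I) T"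
    "subseq (tour ct I (resume ct st Bs)) T'" by blast
  have "path_length I p (tour ct I (resume ct st Bs)) \<le> path_length I p T'"
    using T' assms(1) by (intro path_length_subseq)
  also have "\<dots> \<le> gdist I p (depot I) + path_length I (depot I) T'"
    using T' assms(1) depot_grid by (intro path_length_detour)
  finally show ?thesis using T'(2) by (simp add: T_def)
qed

section \<open>Instances and the optimum\<close>

text \<open>Orders keep their positions in the instance known at some time, because those known form an
  initial segment.\<close>

lemma filter_arrival_prefix:
  "sorted (map fst os) \<Longrightarrow>
     filter (\<lambda>(r, S). r \<le> t) os = take (length (filter (\<lambda>(r, S). r \<le> t) os)) os \<and>
     (\<forall>j < length (filter (\<lambda>(r, S). r \<le> t) os). fst (os ! j) \<le> t) \<and>
     (\<forall>j < length os. length (filter (\<lambda>(r, S). r \<le> t) os) \<le> j \<longrightarrow> t < fst (os ! j))"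
proof (induction os)
  case (Cons a os)
  show ?case
  proof (cases "fst a \<le> t")
    case True
    then show ?thesis using Cons by (auto simp: nth_Cons split: nat.splits prod.splits)
  next
    case False
    then have "\<forall>b \<in> set os. t < fst b" using Cons.prems by fastforce
    moreover from this have "filter (\<lambda>(r, S). r \<le> t) os = []" by (fastforce simp: filter_empty_conv)
    ultimately show ?thesis using False by (auto simp: nth_Cons split: nat.splits prod.splits)
  qed
qed simp

lemma grid_known [simp]: "grid (known I t) = grid I"
  by (simp add: known_def grid_def aisles_def cross_aisles_def)

lemma movement_known [simp]: "movement (known I t) = movement I"
  by (simp add: movement_def fun_eq_iff)

lemma gdist_known [simp]: "gdist (known I t) = gdist I"
  by (simp add: gdist_def fun_eq_iff)

lemma parameters_known [simp]:
  "depot (known I t) = depot I" "capacity (known I t) = capacity I"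
  "wh_length (known I t) = wh_length I" "wh_width (known I t) = wh_width I"
  "n_aisles (known I t) = n_aisles I" "n_cross (known I t) = n_cross I"
  by (simp_all add: known_def)

lemma close_pos_known [simp]: "close_pos ct (known I t) p = close_pos ct I p"
  by (cases ct) (simp_all add: close_pos_def)

lemma timeline_known [simp]: "timeline ct (known I t) \<rho> u p es = timeline ct I \<rho> u p es"
  by (induction ct I \<rho> u p es rule: timeline.induct) (simp_all add: Let_def)

lemma completion_known [simp]: "completion ct (known I t) \<rho> u p Bs = completion ct I \<rho> u p Bs"
  by (simp add: completion_def)

locale valid_instance =
  fixes I :: inst
  assumes valid: "valid_inst I"
begin

sublocale warehouse I
  using valid by unfold_locales (auto simp: valid_inst_def split: if_splits)

lemma warehouse_known: "warehouse (known I t)"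
  using wh depot_grid by unfold_locales simp_all

lemma order_valid:
  assumes "j < length (orders I)"
  shows "finite (snd (orders I ! j))" "snd (orders I ! j) \<noteq> {}" "snd (orders I ! j) \<subseteq> aisles I"
    and arrival_nonneg: "0 \<le> arrival I j"
proof -
  obtain r S where rS: "orders I ! j = (r, S)" by fastforce
  then have "(r, S) \<in> set (orders I)" using nth_mem[OF assms] by simp
  then show "finite (snd (orders I ! j))" "snd (orders I ! j) \<noteq> {}"
    "snd (orders I ! j) \<subseteq> aisles I" "0 \<le> arrival I j"
    using valid by (auto simp: valid_inst_def arrival_def rS)
qed

lemma finite_items: "finite (items I)"
proof (rule finite_subset)
  show "items I \<subseteq> (SIGMA j : {..<length (orders I)}. snd (orders I ! j))"
    by (auto simp: items_def)
  show "finite (SIGMA j : {..<length (orders I)}. snd (orders I ! j))"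
    using order_valid(1) by blast
qed

lemma items_grid: "snd ` items I \<subseteq> grid I"
  using order_valid(3) by (fastforce simp: items_def grid_def)

lemma item_ex:
  assumes "j < length (orders I)"
  shows "\<exists>x \<in> items I. fst x = j"
  using order_valid(2)[OF assms] assms by (fastforce simp: items_def)

lemma arrival_mono: "i \<le> j \<Longrightarrow> j < length (orders I) \<Longrightarrow> arrival I i \<le> arrival I j"
  using valid sorted_nth_mono[of "map fst (orders I)" i j] by (simp add: valid_inst_def arrival_def)

lemma known_prefix:
  "length (orders (known I t)) \<le> length (orders I)"
  "orders (known I t) = take (length (orders (known I t))) (orders I)"
  "j < length (orders (known I t)) \<Longrightarrow> arrival I j \<le> t"
  "length (orders (known I t)) \<le> j \<Longrightarrow> j < length (orders I) \<Longrightarrow> t < arrival I j"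
proof -
  have "sorted (map fst (orders I))" using valid by (simp add: valid_inst_def)
  note prefix = filter_arrival_prefix[OF this, of t]
  show "length (orders (known I t)) \<le> length (orders I)" by (simp add: known_def)
  show "orders (known I t) = take (length (orders (known I t))) (orders I)"
    using prefix by (simp add: known_def)
  show "arrival I j \<le> t" if "j < length (orders (known I t))"
    using prefix that by (simp add: known_def arrival_def)
  show "t < arrival I j" if "length (orders (known I t)) \<le> j" "j < length (orders I)"
    using prefix that by (simp add: known_def arrival_def)
qed

lemma items_known: "items (known I t) = {x \<in> items I. fst x < length (orders (known I t))}"
proof -
  let ?k = "length (orders (known I t))"
  have "orders (known I t) ! j = orders I ! j" if "j < ?k" for j
    by (subst known_prefix(2)) (use that in simp)
  then show ?thesis using known_prefix(1)[of t] by (auto simp: items_def)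
qed

lemma known_all:
  assumes "\<And>j. j < length (orders I) \<Longrightarrow> arrival I j \<le> t"
  shows "known I t = I"
proof -
  have "fst x \<le> t" if "x \<in> set (orders I)" for x
    using assms that by (auto simp: in_set_conv_nth arrival_def)
  then have "filter (\<lambda>(r, S). r \<le> t) (orders I) = orders I"
    by (intro filter_True) auto
  then show ?thesis by (simp add: known_def)
qed

lemma batching_ex: "\<exists>Bs. batching (capacity I) Bs \<and> set (concat Bs) = items I"
proof -
  obtain xs where xs: "set xs = items I" "distinct xs"
    using finite_distinct_list[OF finite_items] by blast
  define n where "n = length (orders I)"
  define Bs where "Bs = map (\<lambda>j. filter (\<lambda>x. fst x = j) xs) [0..<n]"
  have set_Bs: "set (concat Bs) = items I"
    by (auto simp: Bs_def xs n_def items_def)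
  have "distinct (concat (map (\<lambda>j. filter (\<lambda>x. fst x = j) xs) [0..<m]))" for m
    using xs(2) by (induction m) auto
  then have "distinct (concat Bs)" by (simp add: Bs_def)
  moreover have "B \<noteq> [] \<and> card (fst ` set B) \<le> capacity I" if B: "B \<in> set Bs" for B
  proof -
    obtain j where j: "j < n" "B = filter (\<lambda>x. fst x = j) xs"
      using B unfolding Bs_def by fastforce
    then have "B \<noteq> []" using item_ex[of j] xs(1) by (auto simp: n_def filter_empty_conv)
    moreover have "card (fst ` set B) \<le> card {j}" by (rule card_mono) (auto simp: j)
    ultimately show ?thesis using valid by (simp add: valid_inst_def)
  qed
  moreover have "sorted_wrt (\<lambda>B B'. fst ` set B \<inter> fst ` set B' = {}) Bs"
    unfolding Bs_def sorted_wrt_map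
    by (rule sorted_wrt_mono_rel[OF _ sorted_wrt_upt]) auto
  ultimately show ?thesis using set_Bs by (auto simp: batching_def)
qed

lemma feasible_init:
  "feasible I (init_state I) Bs \<longleftrightarrow> batching (capacity I) Bs \<and> set (concat Bs) = items I"
  by (simp add: feasible_empty_cart init_state_def del: set_concat)

text \<open>A solution cannot be faster than its tour is long, nor finish before the last arrival. These two
  bounds are all that the analysis of the interventionist systems uses about the value of a solution.\<close>

lemma completion_bounds:
  assumes "feasible I (init_state I) Bs"
  shows "path_length I (depot I) (tour ct I Bs) \<le> completion ct I (arrival I) 0 (depot I) Bs"
    and "j < length (orders I) \<Longrightarrow> arrival I j \<le> completion ct I (arrival I) 0 (depot I) Bs"
proof -
  have Bs: "set (concat Bs) = items I" using assms feasible_init by blast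
  then have in_grid: "snd ` set (concat Bs) \<subseteq> grid I" using items_grid by simp
  show "path_length I (depot I) (tour ct I Bs) \<le> completion ct I (arrival I) 0 (depot I) Bs"
    using completion_ge_length[OF depot_grid in_grid, of 0] by simp
  show "arrival I j \<le> completion ct I (arrival I) 0 (depot I) Bs" if j: "j < length (orders I)"
  proof -
    obtain x where "x \<in> items I" "fst x = j" using item_ex[OF j] by blast
    then show ?thesis
      using completion_ge_arrival[OF depot_grid in_grid, of x "arrival I" ct 0] Bs
      by (simp del: set_concat)
  qed
qed

lemma feasible_nonempty:
  assumes "feasible I (init_state I) Bs"
  shows "Bs \<noteq> []"
proof -
  have "orders I \<noteq> []" using valid by (simp add: valid_inst_def)
  then obtain x where "x \<in> items I" using item_ex[of 0] by auto
  then show ?thesis using assms feasible_init by auto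
qed

text \<open>Comparing with every solution instead of the optimum makes it immaterial whether the infimum is
  attained. The bound \<open>1\<close> on \<open>c\<close> accounts for the convention \<open>0 / 0 = 1\<close>.\<close>

lemma ratio_CIOPT_le:
  assumes "0 \<le> x" "1 \<le> c"
    and "\<And>Bs. feasible I (init_state I) Bs \<Longrightarrow> x \<le> c * completion ct I (arrival I) 0 (depot I) Bs"
  shows "ratio x (CIOPT ct I) \<le> ereal c"
proof -
  have lower: "x / c \<le> CIOPT ct I"
    unfolding CIOPT_def
  proof (rule cInf_greatest)
    show "{completion ct I (arrival I) 0 (depot I) Bs | Bs. feasible I (init_state I) Bs} \<noteq> {}"
      using batching_ex feasible_init by blast
  qed (use assms in \<open>auto simp: divide_le_eq mult.commute\<close>)
  have le: "x \<le> c * CIOPT ct I" using lower assms(2) by (simp add: divide_le_eq mult.commute)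
  show ?thesis
  proof (cases "CIOPT ct I = 0")
    case True
    then show ?thesis using le assms by (simp add: ratio_def)
  next
    case False
    have "0 \<le> CIOPT ct I" using lower assms divide_nonneg_pos[of x c] by linarith
    then have "0 < CIOPT ct I" using False by simp
    then show ?thesis using le by (simp add: ratio_def divide_le_eq)
  qed
qed

section \<open>Interventionist reoptimization\<close>

text \<open>What has to be known about the past at a time of reoptimization: the picker set out from the
  depot at time 0, and the cart is not overloaded.\<close>

definition sound :: "real \<Rightarrow> state \<Rightarrow> bool" where
  "sound t st \<longleftrightarrow> pos st \<in> grid I \<and> gdist I (depot I) (pos st) \<le> t \<and>
     finite (cart st) \<and> card (cart st) \<le> capacity I"

lemma feasible_known_ex: "\<exists>Bs. batching (capacity I) Bs \<and> set (concat Bs) = items (known I t)"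
proof -
  obtain Bs where "batching (capacity I) Bs" "set (concat Bs) = items I"
    using batching_ex by blast
  then show ?thesis
    using batching_restrict[of "capacity I" Bs] set_restrict[of _ Bs]
    by (intro exI[of _ "restrict_plan (\<lambda>x. fst x < length (orders (known I t))) Bs"])
       (simp add: items_known del: set_concat)
qed

lemma optimal_plan_rule:
  assumes "tie_breaking_rule ct \<tau>" "sound t st"
  shows "optimal_plan ct (known I t) t st (\<tau> (known I t) t st)"
proof -
  obtain Bs where Bs: "batching (capacity I) Bs" "set (concat Bs) = items (known I t)"
    using feasible_known_ex by blast
  have "\<exists>P. optimal_plan ct (known I t) t st P"
  proof (rule warehouse.optimal_plan_ex[OF warehouse_known])
    show "feasible (known I t) st (resume ct st Bs)"
      using Bs assms(2) by (intro feasible_resume) (simp_all add: sound_def)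
    show "finite (items (known I t))" using finite_items by (simp add: items_known)
    show "snd ` items (known I t) \<subseteq> grid (known I t)" using items_grid by (auto simp: items_known)
    show "pos st \<in> grid (known I t)" using assms(2) by (simp add: sound_def)
  qed
  then show ?thesis using assms(1) by (auto simp: tie_breaking_rule_def)
qed

lemma fold_load_pick: "fold load (map Pick B) K = K \<union> fst ` set B"
proof (induction B arbitrary: K)
  case (Cons x B)
  then show ?case by (cases x) simp
qed simp

text \<open>At any moment the cart contains orders of a single batch only, since closing a batch
  empties it.\<close>

lemma card_cart_fold_load:
  assumes "finite K" "card K \<le> c" "Bs \<noteq> [] \<Longrightarrow> card (K \<union> fst ` set (hd Bs)) \<le> c"
    and "\<And>B. B \<in> set Bs \<Longrightarrow> card (fst ` set B) \<le> c"
  shows "finite (fold load (take m (events Bs)) K) \<and> card (fold load (take m (events Bs)) K) \<le> c"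
  using assms
proof (induction Bs arbitrary: K m)
  case (Cons B Bs)
  show ?case
  proof (cases "m \<le> length B")
    case True
    then have eq: "fold load (take m (events (B # Bs))) K = K \<union> fst ` set (take m B)"
      by (simp add: take_map fold_load_pick)
    have "card (K \<union> fst ` set (take m B)) \<le> card (K \<union> fst ` set B)"
      using Cons.prems(1) set_take_subset[of m B] by (intro card_mono) auto
    then show ?thesis using Cons.prems(1,3) unfolding eq by simp
  next
    case False
    define m' where "m' = m - Suc (length B)"
    have m: "m = length B + Suc m'" using False by (simp add: m'_def)
    have eq: "fold load (take m (events (B # Bs))) K = fold load (take m' (events Bs)) {}"
      by (simp add: m)
    show ?thesis
      unfolding eq using Cons.prems(4) by (intro Cons.IH) auto
  qed
qed simp

lemma sound_follow:
  assumes "tie_breaking_rule ct \<tau>" "sound t st" "t \<le> t'"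
  shows "sound t' (follow ct I t st (\<tau> (known I t) t st) t')"
proof -
  obtain Bs \<gamma> where P: "\<tau> (known I t) t st = (Bs, \<gamma>)" by fastforce
  define T where "T = completion ct I (\<lambda>_. t) t (pos st) Bs"
  have opt: "optimal_plan ct (known I t) t st (Bs, \<gamma>)"
    using optimal_plan_rule[OF assms(1,2)] P by simp
  then have feas: "feasible (known I t) st Bs" and \<gamma>: "movement I t T \<gamma>" "\<gamma> t = pos st"
    by (auto simp: optimal_plan_def route_def T_def)
  have tT: "t \<le> T" using \<gamma>(1) by (simp add: movement_def)
  \<comment> \<open>From time \<open>T\<close> on, the picker stays where she is.\<close>
  define u where "u = min t' T"
  have u: "t \<le> u" "u \<le> t'" "u \<le> T" using tT assms(3) by (auto simp: u_def)
  have u_grid: "\<gamma> u \<in> grid I" using \<gamma>(1) u by (auto simp: movement_def image_subset_iff)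
  have "gdist I (depot I) (\<gamma> u) \<le> gdist I (depot I) (pos st) + gdist I (pos st) (\<gamma> u)"
    using depot_grid assms(2) u_grid by (intro gdist_triangle) (auto simp: sound_def)
  also have "gdist I (pos st) (\<gamma> u) \<le> u - t"
    using gdist_movement[OF movement_subinterval[OF \<gamma>(1) order_refl u(1,3)]] \<gamma>(2) by simp
  also have "gdist I (depot I) (pos st) \<le> t" using assms(2) by (simp add: sound_def)
  finally have dist: "gdist I (depot I) (\<gamma> u) \<le> t'" using u by simp
  have fin: "finite (cart st)" "card (cart st) \<le> capacity I"
    using assms(2) by (auto simp: sound_def)
  have batch: "card (batch_orders st Bs i) \<le> capacity I" if "i < length Bs" for i
    using feas that by (simp add: feasible_def)
  have "finite (fold load (take m (events Bs)) (cart st)) \<and>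
      card (fold load (take m (events Bs)) (cart st)) \<le> capacity I" for m
  proof (rule card_cart_fold_load[OF fin])
    show "card (cart st \<union> fst ` set (hd Bs)) \<le> capacity I" if "Bs \<noteq> []"
      using batch[of 0] that by (simp add: batch_orders_def hd_conv_nth Un_commute)
    show "card (fst ` set B) \<le> capacity I" if B: "B \<in> set Bs" for B
    proof -
      obtain i where i: "i < length Bs" "B = Bs ! i" using B by (auto simp: in_set_conv_nth)
      have "card (fst ` set B) \<le> card (batch_orders st Bs i)"
        using fin(1) by (intro card_mono) (auto simp: batch_orders_def i)
      then show ?thesis using batch[OF i(1)] by simp
    qed
  qed
  then show ?thesis
    using u_grid dist by (simp add: sound_def P follow_def Let_def u_def T_def)
qed

lemma reopt_from_last:
  assumes "tie_breaking_rule ct \<tau>" "ts \<noteq> []" "sorted ts" "sound (hd ts) st"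
  shows "\<exists>st'. sound (last ts) st' \<and> reopt_from ct \<tau> I st ts =
     completion ct I (\<lambda>_. last ts) (last ts) (pos st') (fst (\<tau> (known I (last ts)) (last ts) st'))"
  using assms(2-4)
proof (induction ts arbitrary: st rule: induct_list012)
  case (3 t t' ts)
  then show ?case using sound_follow[OF assms(1), of t st t'] by simp
next
  case (2 t)
  then show ?case by (intro exI[of _ st]) simp
qed simp

text \<open>At the last arrival, at time \<open>t\<close>, the picker is within distance \<open>t\<close> of the depot. Walking
  back to the depot and then running along the tour of an arbitrary solution in two passes is a
  possible continuation. It costs \<open>t\<close> plus twice the length of the tour, and the last plan is no
  worse. Each of these three amounts, as well as \<open>t\<close> for the time elapsed, is at most the value
  of the solution.\<close>

lemma reopt_interventionist_le:
  assumes "tie_breaking_rule ct \<tau>" "feasible I (init_state I) Bs"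
  shows "0 \<le> reopt_interventionist ct \<tau> I"
    and "reopt_interventionist ct \<tau> I \<le> 4 * completion ct I (arrival I) 0 (depot I) Bs"
proof -
  define ts where "ts = remdups (map fst (orders I))"
  define t where "t = last ts"
  define C where "C = completion ct I (arrival I) 0 (depot I) Bs"
  have "map fst (orders I) = map (arrival I) [0..<length (orders I)]"
    by (rule nth_equalityI) (auto simp: arrival_def)
  then have set_ts: "set ts = arrival I ` {..<length (orders I)}"
    by (simp add: ts_def lessThan_atLeast0 del: set_map) simp
  have ts: "ts \<noteq> []" "sorted ts"
    using valid by (auto simp: ts_def valid_inst_def)
  have nonneg: "0 \<le> u" if "u \<in> set ts" for u using that arrival_nonneg by (auto simp: set_ts)
  have "sound (hd ts) (init_state I)"
    using nonneg[OF hd_in_set[OF ts(1)]] depot_grid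
    by (simp add: sound_def init_state_def gdist_refl)
  then obtain st where st: "sound t st"
    and reopt: "reopt_interventionist ct \<tau> I
      = completion ct I (\<lambda>_. t) t (pos st) (fst (\<tau> (known I t) t st))"
    using reopt_from_last[OF assms(1) ts(1,2)]
    unfolding reopt_interventionist_def ts_def[symmetric] t_def by blast
  have "u \<le> t" if "u \<in> set ts" for u
  proof -
    have split: "ts = butlast ts @ [t]" using ts(1) by (simp add: t_def)
    have "sorted (butlast ts @ [t])" "u \<in> set (butlast ts @ [t])"
      using ts(2) that split by simp_all
    then show ?thesis by (auto simp: sorted_append)
  qed
  then have all: "known I t = I" by (intro known_all) (auto simp: set_ts)
  have t: "0 \<le> t" "t \<le> C"
  proof -
    have "t \<in> set ts" using ts(1) by (simp add: t_def)
    then show "0 \<le> t" "t \<le> C"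
      using nonneg completion_bounds(2)[OF assms(2)] by (auto simp: set_ts C_def)
  qed
  obtain Ps \<gamma> where P: "\<tau> (known I t) t st = (Ps, \<gamma>)" by fastforce
  have opt: "optimal_plan ct I t st (Ps, \<gamma>)"
    using optimal_plan_rule[OF assms(1) st] P all by simp
  have pos: "pos st \<in> grid I" "gdist I (pos st) (depot I) \<le> t"
    using st gdist_commute[of "pos st" "depot I"] depot_grid by (auto simp: sound_def)
  have "set (concat Ps) \<subseteq> items I" using opt by (auto simp: optimal_plan_def feasible_def)
  then have Ps: "snd ` set (concat Ps) \<subseteq> grid I" using items_grid by blast
  have "0 \<le> path_length I (pos st) (tour ct I Ps)"
    using pos(1) tour_grid[OF Ps] by (rule path_length_nonneg)
  then show "0 \<le> reopt_interventionist ct \<tau> I"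
    unfolding reopt P using t completion_immediate[OF pos(1) Ps] by simp
  have Bs: "batching (capacity I) Bs" "set (concat Bs) = items I"
    using assms(2) feasible_init by auto
  have resume: "feasible I st (resume ct st Bs)"
    using Bs st by (intro feasible_resume) (auto simp: sound_def simp del: set_concat)
  then have "set (concat (resume ct st Bs)) \<subseteq> items I" by (auto simp: feasible_def)
  then have resume_grid: "snd ` set (concat (resume ct st Bs)) \<subseteq> grid I" using items_grid by blast
  have "reopt_interventionist ct \<tau> I \<le> completion ct I (\<lambda>_. t) t (pos st) (resume ct st Bs)"
    unfolding reopt P using opt resume by (auto simp: optimal_plan_def)
  also have "\<dots> = t + path_length I (pos st) (tour ct I (resume ct st Bs))"
    using completion_immediate[OF pos(1) resume_grid] .
  also have "path_length I (pos st) (tour ct I (resume ct st Bs))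
      \<le> t + 2 * path_length I (depot I) (tour ct I Bs)"
    using path_length_resume[OF pos(1) _ feasible_nonempty[OF assms(2)], of ct st] Bs items_grid pos(2)
    by (simp del: set_concat)
  also have "path_length I (depot I) (tour ct I Bs) \<le> C"
    using completion_bounds(1)[OF assms(2)] by (simp add: C_def)
  finally show "reopt_interventionist ct \<tau> I \<le> 4 * completion ct I (arrival I) 0 (depot I) Bs"
    using t unfolding C_def[symmetric] by linarith
qed

end

section \<open>Non-interventionist reoptimization\<close>

context valid_instance
begin

abbreviation tour_length :: "item list list \<Rightarrow> real" where
  "tour_length Bs \<equiv> path_length I (depot I) (tour Pushcart I Bs)"

text \<open>Every batch starts and ends at the depot.\<close>

lemma tour_length_append: "tour_length (Bs @ Bs') = tour_length Bs + tour_length Bs'"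
proof (cases "Bs = []")
  case False
  then show ?thesis
    using last_tour_pushcart[OF False, of "depot I" I] by (simp add: path_length_append del: last.simps)
qed simp

text \<open>If the items selected by \<open>Q\<close> arrive at time \<open>t\<close> or later, any solution still has to run
  through its tour from the first such item \<open>x\<close> on after time \<open>t\<close>. This part, preceded by the way
  from the depot to \<open>x\<close>, is a tour for the selected items, and \<open>x\<close> is at most half the length of
  the whole tour away from the depot.\<close>

lemma late_items:
  assumes in_grid: "snd ` set (concat Bs) \<subseteq> grid I"
    and late: "\<And>x. x \<in> set (concat Bs) \<Longrightarrow> Q x \<Longrightarrow> t \<le> \<rho> (fst x)"
    and ex: "\<exists>x \<in> set (concat Bs). Q x"
  shows "t + tour_length (restrict_plan Q Bs)
      \<le> completion Pushcart I \<rho> 0 (depot I) Bs + tour_length Bs / 2"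
proof -
  have "\<exists>B \<in> set Bs. \<exists>x \<in> set B. Q x" using ex by auto
  then obtain Bs1 B Bs2 where Bs: "Bs = Bs1 @ B # Bs2" "\<exists>x \<in> set B. Q x"
    "\<forall>B \<in> set Bs1. \<not> (\<exists>x \<in> set B. Q x)"
    using split_list_first_prop[of Bs "\<lambda>B. \<exists>x \<in> set B. Q x"] by blast
  obtain B1 x B2 where B: "B = B1 @ x # B2" "Q x" "\<forall>y \<in> set B1. \<not> Q y"
    using split_list_first_prop[OF Bs(2)] by blast
  have grid: "snd x \<in> grid I" "set (tour Pushcart I Bs) \<subseteq> grid I"
      "set (tour Pushcart I (B2 # Bs2)) \<subseteq> grid I"
    using in_grid tour_grid[OF in_grid] tour_grid[of "B2 # Bs2"] by (auto simp: Bs(1) B(1))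
  have "restrict_plan Q Bs1 = []" "filter Q B1 = []"
    using Bs(3) B(3) by (auto simp: restrict_plan_def filter_empty_conv)
  then have restr: "tour Pushcart I (restrict_plan Q Bs)
      = snd x # map snd (filter Q B2) @ [depot I] @ tour Pushcart I (restrict_plan Q Bs2)"
    using B(2) by (simp add: Bs(1) B(1))
  have "subseq (map snd (filter Q B2) @ [depot I] @ tour Pushcart I (restrict_plan Q Bs2))
      (map snd B2 @ [depot I] @ tour Pushcart I Bs2)"
    by (intro list_emb_append_mono subseq_map subseq_filter_left subseq_tour_restrict) simp
  then have "path_length I (snd x)
        (map snd (filter Q B2) @ [depot I] @ tour Pushcart I (restrict_plan Q Bs2))
      \<le> path_length I (snd x) (tour Pushcart I (B2 # Bs2))"
    using grid by (intro path_length_subseq) simp_all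
  then have "tour_length (restrict_plan Q Bs)
      \<le> gdist I (depot I) (snd x) + path_length I (snd x) (tour Pushcart I (B2 # Bs2))"
    unfolding restr by simp
  moreover have "t + path_length I (snd x) (tour Pushcart I (B2 # Bs2))
      \<le> completion Pushcart I \<rho> 0 (depot I) Bs"
  proof -
    have "t \<le> \<rho> (fst x)" using late[of x] B(2) by (auto simp: Bs(1) B(1))
    then show ?thesis
      using completion_ge_rest[OF depot_grid, of Bs1 B1 x B2 Bs2 \<rho> Pushcart 0] in_grid
      by (simp add: Bs(1) B(1) del: set_concat)
  qed
  moreover have "2 * gdist I (depot I) (snd x) \<le> tour_length Bs"
  proof -
    have "subseq ([] @ [snd x] @ [] @ [depot I] @ [])
        ((tour Pushcart I Bs1 @ map snd B1) @ [snd x] @ map snd B2 @ [depot I] @ tour Pushcart I Bs2)"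
      by (intro list_emb_append_mono) auto
    then have "subseq [snd x, depot I] (tour Pushcart I Bs)" by (simp add: Bs(1) B(1))
    then have "path_length I (depot I) [snd x, depot I] \<le> tour_length Bs"
      using grid depot_grid by (intro path_length_subseq)
    then show ?thesis using gdist_commute[OF depot_grid grid(1)] by simp
  qed
  ultimately show ?thesis by linarith
qed

text \<open>The bound on the time \<open>u\<close> at which the current plan will have been carried out, for an
  arbitrary solution \<open>Bs\<close> and \<open>k\<close> orders seen so far. As long as there are unseen orders, \<open>t\<close> is the time of the last
  reoptimization, the end of an idle period since, or 0 initially.\<close>

definition schedule_bound :: "item list list \<Rightarrow> nat \<Rightarrow> real \<Rightarrow> bool" where
  "schedule_bound Bs k u \<longleftrightarrow>
     (if k < length (orders I)
      then \<exists>t. (\<forall>j. k \<le> j \<longrightarrow> j < length (orders I) \<longrightarrow> t \<le> arrival I j) \<and> u \<le> t + tour_length Bs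
      else u \<le> 5 / 2 * completion Pushcart I (arrival I) 0 (depot I) Bs)"

definition invariant :: "item list list \<Rightarrow> depot_state \<Rightarrow> bool" where
  "invariant Bs s \<longleftrightarrow>
     0 \<le> now s \<and> seen s \<le> length (orders I) \<and>
     batching (capacity I) (todo s) \<and>
     set (concat (todo s)) = {x \<in> items I. fst x < seen s} - collected s \<and>
     collected s \<subseteq> {x \<in> items I. fst x < seen s} \<and>
     schedule_bound Bs (seen s) (now s + tour_length (todo s))"

lemma plan_at_depot:
  assumes "tie_breaking_rule Pushcart \<tau>" "0 \<le> t"
    and "st = \<lparr>pos = depot I, picked = P, cart = {}\<rparr>"
  defines "Ps \<equiv> fst (\<tau> (known I t) t st)"
  shows "batching (capacity I) Ps"
    and "set (concat Ps) = items (known I t) - P"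
    and "batching (capacity I) Ps' \<Longrightarrow> set (concat Ps') = items (known I t) - P \<Longrightarrow>
      tour_length Ps \<le> tour_length Ps'"
proof -
  have st: "pos st = depot I" "picked st = P" "cart st = {}" using assms(3) by simp_all
  obtain \<gamma> where \<gamma>: "\<tau> (known I t) t st = (Ps, \<gamma>)" unfolding Ps_def by (metis prod.collapse)
  have "sound t st" using depot_grid assms(2) by (simp add: sound_def st gdist_refl)
  from optimal_plan_rule[OF assms(1) this]
  have opt: "optimal_plan Pushcart (known I t) t st (Ps, \<gamma>)" unfolding \<gamma> .
  have feas: "feasible (known I t) st Bs \<longleftrightarrow>
      batching (capacity I) Bs \<and> set (concat Bs) = items (known I t) - P" for Bs
    using feasible_empty_cart[OF st(3)] by (simp add: st)
  have len: "completion Pushcart I (\<lambda>_. t) t (depot I) Bs = t + tour_length Bs"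
    if "set (concat Bs) = items (known I t) - P" for Bs
  proof (rule completion_immediate[OF depot_grid])
    show "snd ` set (concat Bs) \<subseteq> grid I"
      unfolding that using items_grid by (auto simp: items_known)
  qed
  show Ps: "batching (capacity I) Ps" "set (concat Ps) = items (known I t) - P"
    using opt feas[of Ps] by (simp_all add: optimal_plan_def del: set_concat)
  show "tour_length Ps \<le> tour_length Ps'"
    if "batching (capacity I) Ps'" "set (concat Ps') = items (known I t) - P"
  proof -
    have "completion Pushcart I (\<lambda>_. t) t (depot I) Ps \<le> completion Pushcart I (\<lambda>_. t) t (depot I) Ps'"
      using opt feas[of Ps'] that by (simp add: optimal_plan_def st del: set_concat)
    then show ?thesis using len[OF that(2)] len[OF Ps(2)] by simp
  qed
qed

text \<open>Carrying out a batch moves the length of its tour from the remaining plan to the clock. If a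
  reoptimization does not yet see all orders, its plan is at most as long as the tour of \<open>Bs\<close>, of
  which a part would do. If it does see all orders, it may keep the rest of the previous plan and
  append the late orders in the way \<open>Bs\<close> treats them: the rest ends by \<open>t\<close> plus the length of the
  tour, and the late orders arrive no earlier than \<open>t\<close>. With \<open>C\<close> for the value of \<open>Bs\<close>, this is
  at most \<open>C + (C + C / 2)\<close>.\<close>

lemma invariant_step:
  assumes rule: "tie_breaking_rule Pushcart \<tau>" and feas: "feasible I (init_state I) Bs"
    and inv: "invariant Bs s" and busy: "seen s < length (orders I) \<or> todo s \<noteq> []"
  shows "invariant Bs (depot_step \<tau> I s)"
proof -
  define n where "n = length (orders I)"
  define k where "k = length (orders (known I (now s)))"
  define S where "S = tour_length Bs"
  define C where "C = completion Pushcart I (arrival I) 0 (depot I) Bs"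
  have Bs: "batching (capacity I) Bs" "set (concat Bs) = items I"
    using feas feasible_init by blast+
  have Bs_grid: "snd ` set (concat Bs) \<subseteq> grid I" using Bs(2) items_grid by simp
  have S: "0 \<le> S" "S \<le> C"
    using path_length_nonneg[OF depot_grid tour_grid[OF Bs_grid]] completion_bounds(1)[OF feas]
    by (simp_all add: S_def C_def)
  have items: "items (known I (now s)) = {x \<in> items I. fst x < k}"
    by (simp add: items_known k_def)
  have kn: "k \<le> n" using known_prefix(1) by (simp add: k_def n_def)
  have inv': "0 \<le> now s" "seen s \<le> n" "batching (capacity I) (todo s)"
    "set (concat (todo s)) = {x \<in> items I. fst x < seen s} - collected s"
    "collected s \<subseteq> {x \<in> items I. fst x < seen s}"
    "schedule_bound Bs (seen s) (now s + tour_length (todo s))"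
    using inv unfolding invariant_def n_def by (simp_all del: set_concat)
  consider (reopt) "seen s < k" | (batch) "\<not> seen s < k" "todo s \<noteq> []"
    | (idle) "\<not> seen s < k" "todo s = []"
    by blast
  then show ?thesis
  proof cases
    case reopt
    define st where "st = \<lparr>pos = depot I, picked = collected s, cart = {}\<rparr>"
    define Ps where "Ps = fst (\<tau> (known I (now s)) (now s) st)"
    have step: "depot_step \<tau> I s = s\<lparr>seen := k, todo := Ps\<rparr>"
      using reopt by (simp add: depot_step_def Let_def k_def Ps_def st_def)
    note plan = plan_at_depot[OF rule inv'(1) st_def, folded Ps_def, unfolded items]
    have bound: "schedule_bound Bs k (now s + tour_length Ps)"
    proof (cases "k < n")
      case True
      define Rs where "Rs = restrict_plan (\<lambda>x. fst x < k \<and> x \<notin> collected s) Bs"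
      have "batching (capacity I) Rs" unfolding Rs_def using Bs(1) by (rule batching_restrict)
      moreover have "set (concat Rs) = {x \<in> items I. fst x < k} - collected s"
        unfolding Rs_def set_restrict Bs(2) by auto
      ultimately have "tour_length Ps \<le> tour_length Rs" by (rule plan(3))
      also have "\<dots> \<le> S"
        unfolding S_def Rs_def
        by (intro path_length_subseq subseq_tour_restrict depot_grid tour_grid Bs_grid)
      finally have "now s + tour_length Ps \<le> now s + S" by simp
      moreover have "now s \<le> arrival I j" if "k \<le> j" "j < n" for j
        using known_prefix(4)[of "now s" j] that by (simp add: k_def n_def)
      ultimately show ?thesis
        using True unfolding schedule_bound_def n_def S_def by (auto intro!: exI[of _ "now s"])
    next
      case False
      then have k: "k = n" using kn by simp
      define Rs where "Rs = restrict_plan (\<lambda>x. seen s \<le> fst x) Bs"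
      have Rs: "set (concat Rs) = {x \<in> items I. seen s \<le> fst x}"
        unfolding Rs_def set_restrict Bs(2) ..
      have "batching (capacity I) (todo s @ Rs)"
      proof (rule batching_append[OF inv'(3)])
        show "batching (capacity I) Rs" unfolding Rs_def using Bs(1) by (rule batching_restrict)
        show "fst ` set (concat (todo s)) \<inter> fst ` set (concat Rs) = {}"
          unfolding inv'(4) Rs by auto
      qed
      moreover have "set (concat (todo s @ Rs)) = {x \<in> items I. fst x < k} - collected s"
      proof -
        have "set (concat (todo s @ Rs)) = set (concat (todo s)) \<union> set (concat Rs)" by simp
        also have "\<dots> = items I - collected s" unfolding inv'(4) Rs using inv'(5) by auto
        also have "\<dots> = {x \<in> items I. fst x < k} - collected s"
          by (auto simp: k n_def items_def)
        finally show ?thesis .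
      qed
      ultimately have opt: "tour_length Ps \<le> tour_length (todo s) + tour_length Rs"
        using plan(3)[of "todo s @ Rs"] by (simp only: tour_length_append)
      have new: "seen s < n" using reopt k by simp
      then obtain t where t: "\<And>j. seen s \<le> j \<Longrightarrow> j < n \<Longrightarrow> t \<le> arrival I j"
        "now s + tour_length (todo s) \<le> t + S"
        using inv'(6) unfolding schedule_bound_def n_def S_def by auto
      have "t + tour_length Rs \<le> C + S / 2"
        unfolding Rs_def C_def S_def
      proof (rule late_items[OF Bs_grid])
        show "t \<le> arrival I (fst x)" if "x \<in> set (concat Bs)" "seen s \<le> fst x" for x
          using that t(1)[of "fst x"] unfolding Bs(2) by (auto simp: items_def n_def)
        show "\<exists>x \<in> set (concat Bs). seen s \<le> fst x"
          unfolding Bs(2) using item_ex[of "seen s"] new unfolding n_def by (metis order_refl)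
      qed
      then have "now s + tour_length Ps \<le> 5 / 2 * C" using opt t(2) S by simp
      then show ?thesis using k by (simp add: schedule_bound_def n_def C_def)
    qed
    have "collected s \<subseteq> {x \<in> items I. fst x < k}" using inv'(5) reopt by auto
    then show ?thesis
      using inv'(1) kn plan(1,2) bound unfolding invariant_def step n_def
      by (simp del: set_concat)
  next
    case batch
    then obtain B Rs where todo: "todo s = B # Rs" by (cases "todo s") auto
    have "set B \<subseteq> items I" using inv'(4) todo by auto
    then have "snd ` set (concat [B]) \<subseteq> grid I" using items_grid by auto
    then have "completion Pushcart I (\<lambda>_. now s) (now s) (depot I) [B] = now s + tour_length [B]"
      by (rule completion_immediate[OF depot_grid])
    then have step: "depot_step \<tau> I s
        = s\<lparr>now := now s + tour_length [B], collected := collected s \<union> set B, todo := Rs\<rparr>"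
      using batch by (simp add: depot_step_def Let_def k_def todo)
    have len: "tour_length (todo s) = tour_length [B] + tour_length Rs"
      using tour_length_append[of "[B]" Rs] by (simp add: todo)
    have "0 \<le> tour_length [B]"
      using path_length_nonneg[OF depot_grid tour_grid] \<open>snd ` set (concat [B]) \<subseteq> grid I\<close> by blast
    then have "0 \<le> now s + tour_length [B]" using inv'(1) by simp
    moreover have Rs: "batching (capacity I) Rs" "set B \<inter> set (concat Rs) = {}"
      using batching_ConsD inv'(3) todo by auto
    moreover have "set (concat Rs) = {x \<in> items I. fst x < seen s} - (collected s \<union> set B)"
      using inv'(4) Rs(2) unfolding todo by auto
    moreover have "collected s \<union> set B \<subseteq> {x \<in> items I. fst x < seen s}"
      using inv'(4,5) unfolding todo by auto
    moreover have "schedule_bound Bs (seen s) (now s + tour_length [B] + tour_length Rs)"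
      using inv'(6) unfolding len add.assoc .
    ultimately show ?thesis
      using inv'(2) unfolding invariant_def step n_def
      by (simp del: set_concat tour_simps path_length.simps)
  next
    case idle
    then have new: "seen s < n" using busy by (simp add: n_def)
    have step: "depot_step \<tau> I s = s\<lparr>now := arrival I (seen s)\<rparr>"
      using idle by (simp add: depot_step_def Let_def k_def)
    have "now s \<le> arrival I (seen s)"
      using known_prefix(4)[of "now s" "seen s"] idle new by (simp add: k_def n_def)
    moreover have "\<forall>j. seen s \<le> j \<longrightarrow> j < n \<longrightarrow> arrival I (seen s) \<le> arrival I j"
      using arrival_mono by (simp add: n_def)
    moreover from this have "schedule_bound Bs (seen s) (arrival I (seen s))"
      using new S(1) by (auto simp: schedule_bound_def n_def S_def)
    ultimately show ?thesis
      using inv'(1-5) idle unfolding invariant_def step n_def by simp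
  qed
qed

lemma reopt_noninterventionist_le:
  assumes "tie_breaking_rule Pushcart \<tau>" "feasible I (init_state I) Bs"
  shows "0 \<le> reopt_noninterventionist \<tau> I"
    and "reopt_noninterventionist \<tau> I \<le> 5 / 2 * completion Pushcart I (arrival I) 0 (depot I) Bs"
proof -
  define n where "n = length (orders I)"
  define C where "C = completion Pushcart I (arrival I) 0 (depot I) Bs"
  define busy where "busy = (\<lambda>s :: depot_state. seen s < n \<or> todo s \<noteq> [])"
  define s0 where "s0 = \<lparr>now = 0, seen = 0, collected = {}, todo = []\<rparr>"
  \<comment> \<open>An idle picker neither sees more orders nor shortens her plan, but the clock moves to a time
    at which there is a new order, so that no two idle steps follow each other.\<close>
  define waiting where "waiting (s :: depot_state) = (if length (orders (known I (now s))) \<le> seen s then 1 else 0 :: nat)"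
    for s
  define r where "r = measures [\<lambda>s :: depot_state. n - seen s, \<lambda>s. length (todo s), waiting]"
  have n: "0 < n" using valid by (simp add: n_def valid_inst_def)
  have Bs: "snd ` set (concat Bs) \<subseteq> grid I" using assms(2) feasible_init items_grid by simp
  have "0 \<le> tour_length Bs" using path_length_nonneg[OF depot_grid tour_grid[OF Bs]] .
  then have init: "invariant Bs s0"
    using n arrival_nonneg
    by (auto simp: invariant_def schedule_bound_def s0_def batching_def n_def intro!: exI[of _ 0])
  have dec: "(depot_step \<tau> I s, s) \<in> r" if "invariant Bs s" "busy s" for s
  proof -
    define k where "k = length (orders (known I (now s)))"
    have kn: "k \<le> n" using known_prefix(1) by (simp add: k_def n_def)
    consider (reopt) "seen s < k" | (batch) "k \<le> seen s" "todo s \<noteq> []"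
      | (idle) "k \<le> seen s" "todo s = []"
      by linarith
    then show ?thesis
    proof cases
      case reopt
      then have "seen (depot_step \<tau> I s) = k" by (simp add: depot_step_def Let_def k_def)
      then show ?thesis using reopt kn by (simp add: r_def diff_less_mono2)
    next
      case batch
      then have "seen (depot_step \<tau> I s) = seen s" "todo (depot_step \<tau> I s) = tl (todo s)"
        by (simp_all add: depot_step_def Let_def k_def)
      then show ?thesis using batch by (simp add: r_def)
    next
      case idle
      then have new: "seen s < n" using that(2) by (simp add: busy_def)
      have step: "depot_step \<tau> I s = s\<lparr>now := arrival I (seen s)\<rparr>"
        using idle by (simp add: depot_step_def Let_def k_def)
      have "seen s < length (orders (known I (arrival I (seen s))))"
        using known_prefix(4)[of "arrival I (seen s)" "seen s"] new by (force simp: n_def)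
      then show ?thesis using idle by (simp add: r_def step waiting_def k_def)
    qed
  qed
  have "0 \<le> now (while busy (depot_step \<tau> I) s0) \<and> now (while busy (depot_step \<tau> I) s0) \<le> 5 / 2 * C"
  proof (rule while_rule[where P = "invariant Bs" and r = r])
    show "invariant Bs (depot_step \<tau> I s)" if "invariant Bs s" "busy s" for s
      using invariant_step[OF assms that(1)] that(2) by (simp add: busy_def n_def)
    show "0 \<le> now s \<and> now s \<le> 5 / 2 * C" if "invariant Bs s" "\<not> busy s" for s
      using that by (simp add: invariant_def schedule_bound_def busy_def n_def C_def)
    show "wf r" by (simp add: r_def)
  qed (use init dec in auto)
  then show "0 \<le> reopt_noninterventionist \<tau> I"
    and "reopt_noninterventionist \<tau> I \<le> 5 / 2 * completion Pushcart I (arrival I) 0 (depot I) Bs"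
    by (simp_all add: reopt_noninterventionist_def busy_def n_def s0_def C_def)
qed

end

section \<open>Competitive ratios\<close>

lemma strict_competitive_ratio_le:
  assumes "\<And>I. valid_inst I \<Longrightarrow> ratio (alg I) (CIOPT ct I) \<le> c"
  shows "strict_competitive_ratio ct alg \<le> c"
  unfolding strict_competitive_ratio_def using assms by (intro SUP_least) simp

theorem proposition4:
  "(\<forall>\<tau>. tie_breaking_rule (cart_of PcartN) \<tau> \<longrightarrow>
      strict_competitive_ratio (cart_of PcartN) (Reopt PcartN \<tau>) \<le> ereal (5 / 2)) \<and>
   (\<forall>sys \<in> {Pcart, Robot}. \<forall>\<tau>. tie_breaking_rule (cart_of sys) \<tau> \<longrightarrow>
      strict_competitive_ratio (cart_of sys) (Reopt sys \<tau>) \<le> 4)"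
proof (intro conjI allI ballI impI)
  fix \<tau> assume \<tau>: "tie_breaking_rule (cart_of PcartN) \<tau>"
  show "strict_competitive_ratio (cart_of PcartN) (Reopt PcartN \<tau>) \<le> ereal (5 / 2)"
  proof (rule strict_competitive_ratio_le)
    fix I assume "valid_inst I"
    then interpret valid_instance I by unfold_locales
    obtain Bs where "feasible I (init_state I) Bs" using batching_ex feasible_init by blast
    then show "ratio (Reopt PcartN \<tau> I) (CIOPT (cart_of PcartN) I) \<le> ereal (5 / 2)"
      using \<tau> reopt_noninterventionist_le by (intro ratio_CIOPT_le) auto
  qed
next
  fix sys \<tau> assume sys: "sys \<in> {Pcart, Robot}" and \<tau>: "tie_breaking_rule (cart_of sys) \<tau>"
  have Reopt: "Reopt sys \<tau> I = reopt_interventionist (cart_of sys) \<tau> I" for I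
    using sys by auto
  have "strict_competitive_ratio (cart_of sys) (Reopt sys \<tau>) \<le> ereal 4"
  proof (rule strict_competitive_ratio_le)
    fix I assume "valid_inst I"
    then interpret valid_instance I by unfold_locales
    obtain Bs where "feasible I (init_state I) Bs" using batching_ex feasible_init by blast
    then show "ratio (Reopt sys \<tau> I) (CIOPT (cart_of sys) I) \<le> ereal 4"
      unfolding Reopt using \<tau> reopt_interventionist_le by (intro ratio_CIOPT_le) auto
  qed
  then show "strict_competitive_ratio (cart_of sys) (Reopt sys \<tau>) \<le> 4" by simp
qed

end
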